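(* Let $\Bbbk$ be a field, $S=\Bbbk[x_1,\dots,x_n]$, $i\in[n]$, $j\in\mathbb{Z}$ and $M\in\mathrm{mod}_{\mathbb{Z}^n}S$. Then $$\operatorname{sdepth}_S M=\operatorname{sdepth}_S M^{\triangleleft\langle i,j\rangle}.$$ Consequently, $\operatorname{sdepth}_S M\ge\operatorname{depth}_S M$ holds if and only if $\operatorname{sdepth}_S M^{\triangleleft\langle i,j\rangle}\ge\operatorname{depth}_S M^{\triangleleft\langle i,j\rangle}$ holds.
   Context: $S$ is $\mathbb{Z}^n$-graded with $\deg x_k=\mathbf{e}_k$; $\mathrm{mod}_{\mathbb{Z}^n}S$ is the category of finitely generated $\mathbb{Z}^n$-graded $S$-modules. For $\mathbf{a}\in\mathbb{Z}^n$, $a_k$ is its $k$-th coordinate. For an order-preserving $q:\mathbb{Z}^n\to\mathbb{Z}^n$, $q^*M$ has $(q^*M)_{\mathbf{a}}=M_{q(\mathbf{a})}$, multiplication by $x^{\mathbf{b}}$ from degree $\mathbf{a}$ to $\mathbf{a}+\mathbf{b}$ being multiplication by $x^{q(\mathbf{a}+\mathbf{b})-q(\mathbf{a})}$ in $M$. The map $\sigma_{\langle i,j\rangle}$ fixes coordinates $k\ne i$ and $(\sigma_{\langle i,j\rangle}(\mathbf{a}))_i=a_i-1$ if $a_i\ge j$, $a_i$ if $a_i<j$; $M^{\triangleleft\langle i,j\rangle}:=(\sigma_{\langle i,j\rangle})^*M$. Stanley depth: for $Z\subset\{x_1,\dots,x_n\}$, $\Bbbk[Z]$ is the subalgebra generated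 by $Z$. For a homogeneous $m\in M$, $m\Bbbk[Z]$ is a Stanley space if it is a free $\Bbbk[Z]$-module. A Stanley decomposition of $M$ is a finite direct sum decomposition $M=\bigoplus_{l=1}^s m_l\Bbbk[Z_l]$ as $\mathbb{Z}^n$-graded $\Bbbk$-vector spaces with each $m_l\Bbbk[Z_l]$ a Stanley space; its Stanley depth is $\min_l\#Z_l$, and $\operatorname{sdepth}_S M$ is the maximum of the Stanley depths of all Stanley decompositions of $M$ (for $M\ne 0$). *)

theory Defs
  imports "HOL-Analysis.Finite_Cartesian_Product"
begin

text \<open>
  Z^n-graded S-modules, S = k[x_1..x_n] with deg x_k = e_k, are modelled as
  (external direct sums of) families of k-vector spaces M a (a in Z^n), all living as
  subspaces of an ambient k-vector space of type 'v with scalar multiplication sc,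
  together with the action of monomials: mu a b v = x^b * v for v in M a and b in N^n.
  The index set [n] is the finite type 'n; degrees are int ^ 'n.
\<close>

definition nonneg :: "int ^ 'n::finite \<Rightarrow> bool" where
  "nonneg b \<longleftrightarrow> (\<forall>k. 0 \<le> b $ k)"

definition graded_module ::
  "('k::field \<Rightarrow> 'v::ab_group_add \<Rightarrow> 'v) \<Rightarrow> (int ^ 'n::finite \<Rightarrow> 'v set)
     \<Rightarrow> (int ^ 'n \<Rightarrow> int ^ 'n \<Rightarrow> 'v \<Rightarrow> 'v) \<Rightarrow> bool" where
  "graded_module sc M mu \<longleftrightarrow>
     vector_space sc \<and>
     (\<forall>a. module.subspace sc (M a)) \<and>
     (\<forall>a b. nonneg b \<longrightarrow>
        (\<forall>v\<in>M a. mu a b v \<in> M (a + b)) \<and>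
        (\<forall>v\<in>M a. \<forall>w\<in>M a. mu a b (v + w) = mu a b v + mu a b w) \<and>
        (\<forall>t. \<forall>v\<in>M a. mu a b (sc t v) = sc t (mu a b v))) \<and>
     (\<forall>a. \<forall>v\<in>M a. mu a 0 v = v) \<and>
     (\<forall>a b c. nonneg b \<longrightarrow> nonneg c \<longrightarrow>
        (\<forall>v\<in>M a. mu (a + b) c (mu a b v) = mu a (b + c) v))"

definition fg_graded_module ::
  "('k::field \<Rightarrow> 'v::ab_group_add \<Rightarrow> 'v) \<Rightarrow> (int ^ 'n::finite \<Rightarrow> 'v set)
     \<Rightarrow> (int ^ 'n \<Rightarrow> int ^ 'n \<Rightarrow> 'v \<Rightarrow> 'v) \<Rightarrow> bool" where
  "fg_graded_module sc M mu \<longleftrightarrow> graded_module sc M mu \<and>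
     (\<exists>G. finite G \<and> (\<forall>(a, m)\<in>G. m \<in> M a) \<and>
        (\<forall>c. M c \<subseteq> module.span sc {mu a (c - a) m | a m. (a, m) \<in> G \<and> nonneg (c - a)}))"

definition pull_M :: "(int ^ 'n::finite \<Rightarrow> int ^ 'n) \<Rightarrow> (int ^ 'n \<Rightarrow> 'v set) \<Rightarrow> int ^ 'n \<Rightarrow> 'v set" where
  "pull_M q M = (\<lambda>a. M (q a))"

definition pull_mu :: "(int ^ 'n::finite \<Rightarrow> int ^ 'n) \<Rightarrow> (int ^ 'n \<Rightarrow> int ^ 'n \<Rightarrow> 'v \<Rightarrow> 'v)
     \<Rightarrow> int ^ 'n \<Rightarrow> int ^ 'n \<Rightarrow> 'v \<Rightarrow> 'v" where
  "pull_mu q mu = (\<lambda>a b. mu (q a) (q (a + b) - q a))"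

definition sigma :: "'n::finite \<Rightarrow> int \<Rightarrow> int ^ 'n \<Rightarrow> int ^ 'n" where
  "sigma i j a = (\<chi> k. if k = i \<and> j \<le> a $ i then a $ k - 1 else a $ k)"

text \<open>Stanley decompositions. A decomposition is a finite list of triples (a, m, Z):
  m is homogeneous of degree a, and m k[Z] is the graded subspace whose component in degree c
  is k * x^(c-a) m if c - a in N^n is supported in Z, and 0 otherwise.\<close>
definition supp_in :: "int ^ 'n::finite \<Rightarrow> 'n set \<Rightarrow> bool" where
  "supp_in b Z \<longleftrightarrow> nonneg b \<and> (\<forall>k. k \<notin> Z \<longrightarrow> b $ k = 0)"

definition stanley_comp ::
  "('k::field \<Rightarrow> 'v::ab_group_add \<Rightarrow> 'v) \<Rightarrow> (int ^ 'n::finite \<Rightarrow> int ^ 'n \<Rightarrow> 'v \<Rightarrow> 'v)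
     \<Rightarrow> (int ^ 'n) \<times> 'v \<times> 'n set \<Rightarrow> int ^ 'n \<Rightarrow> 'v set" where
  "stanley_comp sc mu T c = (case T of (a, m, Z) \<Rightarrow>
     (if supp_in (c - a) Z then range (\<lambda>t. sc t (mu a (c - a) m)) else {0}))"

text \<open>m k[Z] is a Stanley space: it is a free k[Z]-module, i.e. f \<mapsto> f m is injective on k[Z];
  by the grading this means x^b m \<noteq> 0 for all monomials x^b in k[Z].\<close>
definition stanley_space ::
  "('k::field \<Rightarrow> 'v::ab_group_add \<Rightarrow> 'v) \<Rightarrow> (int ^ 'n::finite \<Rightarrow> 'v set)
     \<Rightarrow> (int ^ 'n \<Rightarrow> int ^ 'n \<Rightarrow> 'v \<Rightarrow> 'v) \<Rightarrow> (int ^ 'n) \<times> 'v \<times> 'n set \<Rightarrow> bool" where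
  "stanley_space sc M mu T = (case T of (a, m, Z) \<Rightarrow>
     m \<in> M a \<and> (\<forall>b. supp_in b Z \<longrightarrow> mu a b m \<noteq> 0))"

definition stanley_decomposition ::
  "('k::field \<Rightarrow> 'v::ab_group_add \<Rightarrow> 'v) \<Rightarrow> (int ^ 'n::finite \<Rightarrow> 'v set)
     \<Rightarrow> (int ^ 'n \<Rightarrow> int ^ 'n \<Rightarrow> 'v \<Rightarrow> 'v) \<Rightarrow> ((int ^ 'n) \<times> 'v \<times> 'n set) list \<Rightarrow> bool" where
  "stanley_decomposition sc M mu D \<longleftrightarrow>
     (\<forall>T\<in>set D. stanley_space sc M mu T) \<and>
     (\<forall>c. \<forall>v\<in>M c. \<exists>!w. (\<forall>l<length D. w l \<in> stanley_comp sc mu (D ! l) c) \<and>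
                       (\<forall>l\<ge>length D. w l = 0) \<and> v = (\<Sum>l<length D. w l))"

definition sdepth ::
  "('k::field \<Rightarrow> 'v::ab_group_add \<Rightarrow> 'v) \<Rightarrow> (int ^ 'n::finite \<Rightarrow> 'v set)
     \<Rightarrow> (int ^ 'n \<Rightarrow> int ^ 'n \<Rightarrow> 'v \<Rightarrow> 'v) \<Rightarrow> nat" where
  "sdepth sc M mu = Sup {d. \<exists>D. stanley_decomposition sc M mu D \<and>
                               (\<forall>(a, m, Z)\<in>set D. d \<le> card Z)}"

text \<open>Depth via regular sequences. Elements of M: finitely supported families u with u a in M a.
  Polynomials of S: finitely supported coefficient functions on exponent vectors in N^n.\<close>
definition module_elem ::
  "(int ^ 'n::finite \<Rightarrow> 'v::zero set) \<Rightarrow> (int ^ 'n \<Rightarrow> 'v) \<Rightarrow> bool" where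
  "module_elem M u \<longleftrightarrow> finite {a. u a \<noteq> 0} \<and> (\<forall>a. u a \<in> M a)"

definition polynomial :: "(int ^ 'n::finite \<Rightarrow> 'k::zero) \<Rightarrow> bool" where
  "polynomial f \<longleftrightarrow> finite {b. f b \<noteq> 0} \<and> (\<forall>b. f b \<noteq> 0 \<longrightarrow> nonneg b)"

definition pact ::
  "('k::field \<Rightarrow> 'v::ab_group_add \<Rightarrow> 'v) \<Rightarrow> (int ^ 'n::finite \<Rightarrow> int ^ 'n \<Rightarrow> 'v \<Rightarrow> 'v)
     \<Rightarrow> (int ^ 'n \<Rightarrow> 'k) \<Rightarrow> (int ^ 'n \<Rightarrow> 'v) \<Rightarrow> int ^ 'n \<Rightarrow> 'v" where
  "pact sc mu f u = (\<lambda>c. \<Sum>b\<in>{b. f b \<noteq> 0}. sc (f b) (mu (c - b) b (u (c - b))))"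

definition ideal_times ::
  "('k::field \<Rightarrow> 'v::ab_group_add \<Rightarrow> 'v) \<Rightarrow> (int ^ 'n::finite \<Rightarrow> 'v set)
     \<Rightarrow> (int ^ 'n \<Rightarrow> int ^ 'n \<Rightarrow> 'v \<Rightarrow> 'v) \<Rightarrow> (int ^ 'n \<Rightarrow> 'k) list \<Rightarrow> (int ^ 'n \<Rightarrow> 'v) set" where
  "ideal_times sc M mu fs = {u. \<exists>w. (\<forall>l<length fs. module_elem M (w l)) \<and>
        u = (\<lambda>c. \<Sum>l<length fs. pact sc mu (fs ! l) (w l) c)}"

definition regular_sequence ::
  "('k::field \<Rightarrow> 'v::ab_group_add \<Rightarrow> 'v) \<Rightarrow> (int ^ 'n::finite \<Rightarrow> 'v set)
     \<Rightarrow> (int ^ 'n \<Rightarrow> int ^ 'n \<Rightarrow> 'v \<Rightarrow> 'v) \<Rightarrow> (int ^ 'n \<Rightarrow> 'k) list \<Rightarrow> bool" where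
  "regular_sequence sc M mu fs \<longleftrightarrow>
     (\<forall>l<length fs. polynomial (fs ! l) \<and> (fs ! l) 0 = 0 \<and>
        (\<forall>u. module_elem M u \<longrightarrow> pact sc mu (fs ! l) u \<in> ideal_times sc M mu (take l fs)
              \<longrightarrow> u \<in> ideal_times sc M mu (take l fs))) \<and>
     (\<exists>u. module_elem M u \<and> u \<notin> ideal_times sc M mu fs)"

definition depth ::
  "('k::field \<Rightarrow> 'v::ab_group_add \<Rightarrow> 'v) \<Rightarrow> (int ^ 'n::finite \<Rightarrow> 'v set)
     \<Rightarrow> (int ^ 'n \<Rightarrow> int ^ 'n \<Rightarrow> 'v \<Rightarrow> 'v) \<Rightarrow> nat" where
  "depth sc M mu = Sup {length fs | fs. regular_sequence sc M mu fs}"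

end

theory Submission
  imports Defs "HOL-Library.Function_Algebras" "HOL-Library.Infinite_Set"
begin

text \<open>
  Both statements are proved for the pull-back along any coordinate map \<open>p\<close> with a lower adjoint. Since
  \<open>\<sigma>\<close> has a section \<open>\<rho>\<close> of the same kind, \<open>M = \<rho>\<^sup>*\<sigma>\<^sup>*M\<close>, and one inequality for general \<open>p\<close> suffices.

  A Stanley space pulls back to a direct sum of Stanley spaces with the same variable set: one if \<open>x\<^sub>i\<close> is
  among the variables, otherwise one for each point of a fibre of \<open>p\<close>.

  For the depth, a module has a regular sequence of length \<open>d + 1\<close> in the maximal ideal iff it has one of
  length \<open>d\<close>, say \<open>y\<close>, not involving \<open>x\<^sub>i\<close>, such that \<open>M/yM\<close> has zero socle. The latter condition can be
  checked separately in each degree in direction \<open>i\<close>, hence it is inherited, with the same \<open>y\<close>, by the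
  pull-back. The equivalence rests on the exchange property of regular sequences and on the existence of
  a regular element on a Noetherian module with zero socle.
\<close>
section \<open>Regular elements and regular sequences of commuting operators\<close>

text \<open>Regularity is tested by arbitrary, possibly inhomogeneous polynomials, whereas the
  pull-back changes only how x_i acts: over the subring of the other variables it merely repeats or
  omits layers of M of constant i-degree. Hence the insistence on sequences without x_i. Such a
  sequence of full length need not exist (for M = S the depth is n, but only n - 1 variables
  remain), so one element is given up and traded for the socle condition. The field may be finite,
  so no general linear form is at hand; regular elements are built from the variables by sums and
  products alone. \<open>gen_ops\<close> has neither an identity nor scalars, so whatever the
  variables generate stays in the ideal of the variables. That length d can be reached without x_i
  rests on homogeneity in direction i: an obstruction would be divisible by every power of x_i,
  although the degrees of M are bounded below.\<close>

inductive_set gen_ops :: "('x::ab_group_add \<Rightarrow> 'x) set \<Rightarrow> ('x \<Rightarrow> 'x) set" for Z where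
  gen_zero: "(\<lambda>u. 0) \<in> gen_ops Z"
| gen_base: "z \<in> Z \<Longrightarrow> z \<in> gen_ops Z"
| gen_plus: "f \<in> gen_ops Z \<Longrightarrow> g \<in> gen_ops Z \<Longrightarrow> (\<lambda>u. f u + g u) \<in> gen_ops Z"
| gen_comp: "f \<in> gen_ops Z \<Longrightarrow> g \<in> gen_ops Z \<Longrightarrow> (\<lambda>u. f (g u)) \<in> gen_ops Z"

lemma gen_ops_trans:
  assumes "f \<in> gen_ops Z" "Z \<subseteq> gen_ops Y"
  shows "f \<in> gen_ops Y"
  using assms(1) by induction (use assms(2) in \<open>auto intro: gen_ops.intros\<close>)

text \<open>The polynomial ring enters only through the commuting operators \<open>R\<close> that it
  induces on \<open>X\<close>; operators are total functions, and the module laws are required on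
  \<open>X\<close> alone. \<open>noeth\<close> states Noetherianity in the form in which it is used:
  in every sequence some term is a combination of earlier ones.\<close>

locale noetherian_action =
  fixes X :: "'x::ab_group_add set" and R :: "('x \<Rightarrow> 'x) set" and x :: "'i::finite \<Rightarrow> 'x \<Rightarrow> 'x"
  assumes X_zero: "0 \<in> X"
    and X_diff: "u \<in> X \<Longrightarrow> v \<in> X \<Longrightarrow> u - v \<in> X"
    and R_in: "r \<in> R \<Longrightarrow> u \<in> X \<Longrightarrow> r u \<in> X"
    and R_add: "r \<in> R \<Longrightarrow> u \<in> X \<Longrightarrow> v \<in> X \<Longrightarrow> r (u + v) = r u + r v"
    and R_comm: "r \<in> R \<Longrightarrow> s \<in> R \<Longrightarrow> u \<in> X \<Longrightarrow> r (s u) = s (r u)"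
    and R_id: "(\<lambda>u. u) \<in> R"
    and R_plus: "r \<in> R \<Longrightarrow> s \<in> R \<Longrightarrow> (\<lambda>u. r u + s u) \<in> R"
    and R_minus: "r \<in> R \<Longrightarrow> (\<lambda>u. - r u) \<in> R"
    and R_comp: "r \<in> R \<Longrightarrow> s \<in> R \<Longrightarrow> (\<lambda>u. r (s u)) \<in> R"
    and x_in_R: "x k \<in> R"
    and noeth: "(\<And>n::nat. us n \<in> X) \<Longrightarrow> \<exists>N c. (\<forall>s<N. c s \<in> R) \<and> us N = (\<Sum>s<N. c s (us s))"
begin

lemma X_add: "u \<in> X \<Longrightarrow> v \<in> X \<Longrightarrow> u + v \<in> X"
  using X_diff[of u "0 - v"] X_diff[OF X_zero, of v] by simp

lemma X_sum: "(\<And>a. a \<in> I \<Longrightarrow> f a \<in> X) \<Longrightarrow> sum f I \<in> X"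
  by (induction I rule: infinite_finite_induct) (auto intro: X_zero X_add)

lemma R_zero: "(\<lambda>u. 0) \<in> R"
  using R_plus[OF R_id R_minus[OF R_id]] by simp

lemma R_0 [simp]: "r \<in> R \<Longrightarrow> r 0 = 0"
  using R_add[of r 0 0] X_zero by simp

lemma R_diff: "r \<in> R \<Longrightarrow> u \<in> X \<Longrightarrow> v \<in> X \<Longrightarrow> r (u - v) = r u - r v"
  using R_add[of r "u - v" v] X_diff by (simp add: algebra_simps)

lemma R_sum: "r \<in> R \<Longrightarrow> (\<And>a. a \<in> I \<Longrightarrow> f a \<in> X) \<Longrightarrow> r (sum f I) = (\<Sum>a\<in>I. r (f a))"
  by (induction I rule: infinite_finite_induct) (auto simp: R_add X_sum)

lemma gen_in_R: "f \<in> gen_ops Z \<Longrightarrow> Z \<subseteq> R \<Longrightarrow> f \<in> R"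
  by (induction rule: gen_ops.induct) (auto intro: R_zero R_plus R_comp)

lemma R_funpow: "r \<in> R \<Longrightarrow> r ^^ n \<in> R"
proof (induction n)
  case 0
  then show ?case using R_id by (simp add: id_def)
next
  case (Suc n)
  then show ?case using R_comp[of r "r ^^ n"] by (simp add: comp_def)
qed

definition submod :: "'x set \<Rightarrow> bool" where
  "submod K \<longleftrightarrow> K \<subseteq> X \<and> 0 \<in> K \<and> (\<forall>u\<in>K. \<forall>v\<in>K. u - v \<in> K) \<and> (\<forall>r\<in>R. \<forall>u\<in>K. r u \<in> K)"

lemma submodD:
  assumes "submod K"
  shows "u \<in> K \<Longrightarrow> u \<in> X" "0 \<in> K" "u \<in> K \<Longrightarrow> v \<in> K \<Longrightarrow> u - v \<in> K"
    "u \<in> K \<Longrightarrow> v \<in> K \<Longrightarrow> u + v \<in> K" "r \<in> R \<Longrightarrow> u \<in> K \<Longrightarrow> r u \<in> K"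
proof -
  show "u + v \<in> K" if "u \<in> K" "v \<in> K"
  proof -
    have "u - (0 - v) \<in> K" using assms that unfolding submod_def by blast
    then show ?thesis by simp
  qed
qed (use assms in \<open>auto simp: submod_def\<close>)

lemma submod_sum: "submod K \<Longrightarrow> (\<And>a. a \<in> I \<Longrightarrow> f a \<in> K) \<Longrightarrow> sum f I \<in> K"
  by (induction I rule: infinite_finite_induct) (auto intro: submodD)

lemma submod_combination:
  assumes "submod K" "\<And>a. a \<in> I \<Longrightarrow> c a \<in> R" "\<And>a. a \<in> I \<Longrightarrow> f a \<in> K"
  shows "(\<Sum>a\<in>I. c a (f a)) \<in> K"
  using submodD(5)[OF assms(1) assms(2,3)] by (rule submod_sum[OF assms(1)])

lemma submod_zero: "submod {0}"
  by (auto simp: submod_def X_zero)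

text \<open>Quotient modules are never formed: a submodule \<open>K\<close> stands for X/K, and
  \<open>ext K y\<close> for the quotient of X/K by the image of \<open>y\<close>.
  \<open>reg\<close> and \<open>soc0\<close> are likewise properties of X/K.\<close>

definition ext :: "'x set \<Rightarrow> ('x \<Rightarrow> 'x) \<Rightarrow> 'x set" where
  "ext K y = {k + y u | k u. k \<in> K \<and> u \<in> X}"

lemma extI: "k \<in> K \<Longrightarrow> u \<in> X \<Longrightarrow> k + y u \<in> ext K y"
  by (auto simp: ext_def)

lemma ext_left:
  assumes "y \<in> R" "k \<in> K" shows "k \<in> ext K y"
  using extI[OF assms(2) X_zero, of y] assms(1) by simp

lemma submod_ext:
  assumes K: "submod K" and y: "y \<in> R"
  shows "submod (ext K y)"
  unfolding submod_def
proof (intro conjI ballI)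
  show "ext K y \<subseteq> X"
    using R_in[OF y] submodD(1)[OF K] by (auto simp: ext_def intro!: X_add)
  show "0 \<in> ext K y" using ext_left[OF y] submodD(2)[OF K] by simp
next
  fix a b assume "a \<in> ext K y" "b \<in> ext K y"
  then obtain k u l v where "a = k + y u" "b = l + y v" "k \<in> K" "l \<in> K" "u \<in> X" "v \<in> X"
    by (auto simp: ext_def)
  then have "a - b = (k - l) + y (u - v)" "k - l \<in> K" "u - v \<in> X"
    using y K by (auto simp: R_diff X_diff submodD(3))
  then show "a - b \<in> ext K y" by (auto simp: ext_def)
next
  fix r a assume r: "r \<in> R" and "a \<in> ext K y"
  then obtain k u where ku: "a = k + y u" "k \<in> K" "u \<in> X"
    by (auto simp: ext_def)
  then have "r a = r k + y (r u)" "r k \<in> K" "r u \<in> X"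
    using r y K submodD(1)[OF K ku(2)] by (auto simp: R_add R_in R_comm submodD(5))
  then show "r a \<in> ext K y" by (auto simp: ext_def)
qed

lemma ext_commute: "ext (ext K y) z = ext (ext K z) y"
proof -
  have "ext (ext K y) z \<subseteq> ext (ext K z) y" for y z
  proof
    fix a assume "a \<in> ext (ext K y) z"
    then obtain k u v where "a = k + y u + z v" "k \<in> K" "u \<in> X" "v \<in> X"
      by (auto simp: ext_def)
    then have "a = (k + z v) + y u" "k + z v \<in> ext K z" "u \<in> X"
      by (auto intro: extI simp: ac_simps)
    then show "a \<in> ext (ext K z) y" by (auto intro: extI)
  qed
  then show ?thesis by blast
qed

definition reg :: "('x \<Rightarrow> 'x) \<Rightarrow> 'x set \<Rightarrow> bool" where
  "reg y K \<longleftrightarrow> (\<forall>u\<in>X. y u \<in> K \<longrightarrow> u \<in> K)"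

text \<open>With \<open>A = UNIV\<close> this is the vanishing of the socle of X/K; the case
  \<open>A = - {i}\<close> yields regular elements free of x_i.\<close>

definition soc0 :: "'i set \<Rightarrow> 'x set \<Rightarrow> bool" where
  "soc0 A K \<longleftrightarrow> (\<forall>u\<in>X. (\<forall>k\<in>A. x k u \<in> K) \<longrightarrow> u \<in> K)"

section \<open>Existence of regular elements\<close>

text \<open>The operators \<open>g s = f + w s\<close> behave like Euclid's numbers: \<open>w s\<close> is \<open>z\<close> times the product of
  all earlier \<open>g\<close>'s. By Noetherianity some \<open>u N\<close> killed by \<open>g N\<close> is also killed by that
  product, hence by \<open>f\<close>; and \<open>w s\<close> acts as a power of \<open>z\<close> on the kernel of \<open>f\<close>.\<close>
lemma combine_regular:
  assumes fin: "finite \<K>" and K: "\<And>K. K \<in> \<K> \<Longrightarrow> submod K" and f: "f \<in> R" and z: "z \<in> R"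
  shows "\<exists>g\<in>gen_ops {f, z}. \<forall>K\<in>\<K>. \<forall>u\<in>X. g u \<in> K \<longrightarrow> f u \<in> K \<and> (\<exists>N. (z ^^ N) u \<in> K)"
proof -
  define w where "w = rec_nat z (\<lambda>s w u. f (w u) + w (w u))"
  have w0: "w 0 = z" and wS: "w (Suc s) = (\<lambda>u. f (w s u) + w s (w s u))" for s
    by (simp_all add: w_def)
  define g where "g s = (\<lambda>u. f u + w s u)" for s
  have wg: "w s \<in> gen_ops {f, z}" for s
  proof (induction s)
    case 0
    then show ?case unfolding w0 by (intro gen_base) simp
  next
    case (Suc s)
    have "f \<in> gen_ops {f, z}" by (intro gen_base) simp
    then show ?case unfolding wS using Suc gen_plus[OF gen_comp[OF _ Suc] gen_comp[OF Suc Suc]] by blast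
  qed
  have gg: "g s \<in> gen_ops {f, z}" for s
    unfolding g_def by (intro gen_plus wg gen_base) simp
  have wR: "w s \<in> R" and gR: "g s \<in> R" for s
    using gen_in_R[OF wg] gen_in_R[OF gg] f z by auto
  have wSg: "w (Suc s) u = g s (w s u)" for s u
    by (simp add: wS g_def)
  have div: "w t u \<in> K" if "K \<in> \<K>" "u \<in> X" "g s u \<in> K" "s < t" for K u s t
    using that(4)
  proof (induction t)
    case (Suc t)
    show ?case
    proof (cases "s = t")
      case True
      have "w (Suc t) u = w t (g t u)" using wSg R_comm[OF gR wR that(2)] by simp
      then show ?thesis using True that(3) submodD(5)[OF K[OF that(1)] wR] by simp
    next
      case False
      then show ?thesis using Suc submodD(5)[OF K[OF that(1)] gR] by (simp add: wSg)
    qed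
  qed simp
  have pow: "\<exists>N. (z ^^ N) u \<in> K" if "K \<in> \<K>" "u \<in> X" "f u \<in> K" "w s u \<in> K" for K u s
    using that(2-4)
  proof (induction s arbitrary: u)
    case 0
    then have "(z ^^ 1) u \<in> K" by (simp add: w0)
    then show ?case by blast
  next
    case (Suc s)
    note SK = K[OF that(1)]
    have X: "w s u \<in> X" using Suc R_in[OF wR] by simp
    have fw: "f (w s u) \<in> K"
      using R_comm[OF f wR Suc.prems(1)] submodD(5)[OF SK wR Suc.prems(2)] by simp
    have "w s (w s u) = w (Suc s) u - f (w s u)" by (simp add: wS)
    then have "w s (w s u) \<in> K" using fw Suc.prems(3) submodD(3)[OF SK] by simp
    then obtain N where N: "(z ^^ N) (w s u) \<in> K" using Suc.IH[OF X fw] by blast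
    note zN = R_funpow[OF z, of N]
    have "w s ((z ^^ N) u) \<in> K" using N R_comm[OF zN wR Suc.prems(1)] by simp
    moreover have "f ((z ^^ N) u) \<in> K"
      using R_comm[OF f zN Suc.prems(1)] submodD(5)[OF SK zN Suc.prems(2)] by simp
    ultimately obtain N' where "(z ^^ N') ((z ^^ N) u) \<in> K"
      using Suc.IH[OF R_in[OF zN Suc.prems(1)]] by blast
    then have "(z ^^ (N' + N)) u \<in> K" by (simp add: funpow_add)
    then show ?case by blast
  qed
  define good where "good K u \<longleftrightarrow> f u \<in> K \<and> (\<exists>N. (z ^^ N) u \<in> K)" for K u
  have "\<exists>s. \<forall>K\<in>\<K>. \<forall>u\<in>X. g s u \<in> K \<longrightarrow> good K u"
  proof (rule ccontr)
    assume "\<not> ?thesis"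
    then have "\<forall>s. \<exists>K u. K \<in> \<K> \<and> u \<in> X \<and> g s u \<in> K \<and> \<not> good K u" by blast
    then obtain Kf uf where Ku: "\<And>s. Kf s \<in> \<K>" "\<And>s. uf s \<in> X" "\<And>s. g s (uf s) \<in> Kf s"
      "\<And>s. \<not> good (Kf s) (uf s)" by metis
    have "finite (range Kf)" using Ku(1) fin by (meson finite_subset image_subsetI)
    then obtain s0 where "infinite {s \<in> UNIV. Kf s = Kf s0}"
      using pigeonhole_infinite[of UNIV Kf] by auto
    then obtain r :: "nat \<Rightarrow> nat" where r: "strict_mono r" "\<And>n. Kf (r n) = Kf s0"
      using infinite_enumerate[of "{s. Kf s = Kf s0}"] by auto
    define L where "L = Kf s0"
    have L: "L \<in> \<K>" "submod L" using Ku(1) K by (auto simp: L_def)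
    obtain N c where c: "\<And>s. s < N \<Longrightarrow> c s \<in> R" and eq: "uf (r N) = (\<Sum>s<N. c s (uf (r s)))"
      using noeth[of "\<lambda>n. uf (r n)"] Ku(2) by auto
    have "w (r N) (uf (r N)) = (\<Sum>s<N. w (r N) (c s (uf (r s))))"
      unfolding eq using Ku(2) c by (intro R_sum[OF wR]) (auto intro: R_in)
    also have "\<dots> = (\<Sum>s<N. c s (w (r N) (uf (r s))))"
      by (intro sum.cong refl R_comm[OF wR c Ku(2)]) auto
    also have "\<dots> \<in> L"
    proof (intro submod_sum[OF L(2)] submodD(5)[OF L(2) c])
      fix s assume s: "s \<in> {..<N}"
      show "w (r N) (uf (r s)) \<in> L"
        using div[OF L(1) Ku(2), of "r s" "r s" "r N"] Ku(3)[of "r s"] s r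
        by (auto simp: L_def strict_mono_less)
    qed auto
    finally have wL: "w (r N) (uf (r N)) \<in> L" .
    have "g (r N) (uf (r N)) - w (r N) (uf (r N)) \<in> L"
      using submodD(3)[OF L(2) _ wL] Ku(3)[of "r N"] r(2) by (simp add: L_def)
    then have fL: "f (uf (r N)) \<in> L" by (simp add: g_def)
    have "good L (uf (r N))" unfolding good_def
      using fL pow[OF L(1) Ku(2) fL wL] by blast
    then show False using Ku(4)[of "r N"] r(2) by (simp add: L_def)
  qed
  then show ?thesis using gg unfolding good_def by blast
qed

text \<open>The variables are added one at a time by \<open>combine_regular\<close>; for no
  variables the zero operator serves, the conclusion being vacuous. The resulting \<open>g\<close>
  is regular up to torsion with respect to the variables in \<open>A\<close>. Several submodules are
  treated at once because the exchange property calls for one element regular modulo all of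
  them.\<close>

lemma ex_gen_power:
  assumes fin: "finite \<K>" and K: "\<And>K. K \<in> \<K> \<Longrightarrow> submod K"
  shows "\<exists>g\<in>gen_ops (x ` A). \<forall>K\<in>\<K>. \<forall>u\<in>X. g u \<in> K \<longrightarrow> (\<forall>k\<in>A. \<exists>N. (x k ^^ N) u \<in> K)"
  using finite[of A]
proof (induction A rule: finite_induct)
  case empty
  show ?case using gen_zero by blast
next
  case (insert a A)
  then obtain f where f: "f \<in> gen_ops (x ` A)"
    and fK: "\<forall>K\<in>\<K>. \<forall>u\<in>X. f u \<in> K \<longrightarrow> (\<forall>k\<in>A. \<exists>N. (x k ^^ N) u \<in> K)" by blast
  have fR: "f \<in> R" by (rule gen_in_R[OF f]) (auto simp: x_in_R)
  obtain g where g: "g \<in> gen_ops {f, x a}"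
    and gK: "\<forall>K\<in>\<K>. \<forall>u\<in>X. g u \<in> K \<longrightarrow> f u \<in> K \<and> (\<exists>N. (x a ^^ N) u \<in> K)"
    using combine_regular[OF fin K fR x_in_R, of a] by blast
  have "g \<in> gen_ops (x ` insert a A)"
    by (rule gen_ops_trans[OF g]) (auto intro: gen_base gen_ops_trans[OF f])
  then show ?case using gK fK by blast
qed

text \<open>Induction on the sum of the exponents: \<open>x k u\<close> satisfies the hypothesis
  with \<open>N k\<close> lowered by one, so every \<open>x k u\<close> lies in \<open>K\<close> and
  the socle condition applies. As soon as one exponent is 0, \<open>u\<close> itself lies in
  \<open>K\<close>.\<close>

lemma soc0_power:
  assumes K: "submod K" and s: "soc0 A K" and u: "u \<in> X"
    and N: "\<And>k. k \<in> A \<Longrightarrow> (x k ^^ N k) u \<in> K"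
  shows "u \<in> K"
  using u N
proof (induction "\<Sum>k\<in>A. N k" arbitrary: u N rule: less_induct)
  case less
  show ?case
  proof (cases "\<exists>k\<in>A. N k = 0")
    case True
    then obtain k where "k \<in> A" "N k = 0" by blast
    then show ?thesis using less.prems(2)[of k] by simp
  next
    case False
    have "x k u \<in> K" if k: "k \<in> A" for k
    proof -
      define N' where "N' = N(k := N k - 1)"
      have "(\<Sum>l\<in>A. N' l) < (\<Sum>l\<in>A. N l)"
        using k False by (intro sum_strict_mono_ex1) (auto simp: N'_def intro: bexI[of _ k])
      moreover have "(x l ^^ N' l) (x k u) \<in> K" if l: "l \<in> A" for l
      proof (cases "l = k")
        case True
        then have "N k = Suc (N' l)" using False k by (auto simp: N'_def)
        then show ?thesis using less.prems(2)[OF k] True by (simp del: funpow.simps add: funpow_Suc_right)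
      next
        case F: False
        have "(x l ^^ N l) (x k u) = x k ((x l ^^ N l) u)"
          by (rule R_comm[OF R_funpow[OF x_in_R] x_in_R less.prems(1)])
        then show ?thesis using less.prems(2)[OF l] F submodD(5)[OF K x_in_R] by (simp add: N'_def)
      qed
      ultimately show ?thesis
        using less.hyps[of N' "x k u"] R_in[OF x_in_R less.prems(1)] by blast
    qed
    then show ?thesis using s less.prems(1) by (auto simp: soc0_def)
  qed
qed

text \<open>Takes the place of prime avoidance: the vanishing socle excludes the torsion left over
  by \<open>ex_gen_power\<close>.\<close>

lemma ex_regular:
  assumes fin: "finite \<K>" and K: "\<And>K. K \<in> \<K> \<Longrightarrow> submod K \<and> soc0 A K"
  shows "\<exists>g\<in>gen_ops (x ` A). \<forall>K\<in>\<K>. reg g K"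
proof -
  obtain g where g: "g \<in> gen_ops (x ` A)"
    and gK: "\<forall>K\<in>\<K>. \<forall>u\<in>X. g u \<in> K \<longrightarrow> (\<forall>k\<in>A. \<exists>N. (x k ^^ N) u \<in> K)"
    using ex_gen_power[OF fin, of A] K by blast
  have "reg g K" if "K \<in> \<K>" for K
    unfolding reg_def
  proof (intro ballI impI)
    fix u assume u: "u \<in> X" "g u \<in> K"
    then have "\<forall>k\<in>A. \<exists>N. (x k ^^ N) u \<in> K" using gK that by blast
    then obtain N where "\<forall>k\<in>A. (x k ^^ N k) u \<in> K" by metis
    then show "u \<in> K" using soc0_power[of K A u N] K[OF that] u by blast
  qed
  then show ?thesis using g by blast
qed

section \<open>The ideal of the variables, depth of quotients and the exchange property\<close>

text \<open>The ideal generated by the variables, as operators. The socle arguments expand its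
  elements in the variables; the expansion is required on \<open>X\<close> only, where operators are
  meaningful.\<close>

definition J :: "('x \<Rightarrow> 'x) set" where
  "J = {f \<in> R. \<exists>c. (\<forall>k. c k \<in> R) \<and> (\<forall>u\<in>X. f u = (\<Sum>k\<in>UNIV. c k (x k u)))}"

lemma J_in_R: "f \<in> J \<Longrightarrow> f \<in> R" by (simp add: J_def)

lemma zero_J: "(\<lambda>u. 0) \<in> J"
  unfolding J_def using R_zero by (auto intro!: exI[of _ "\<lambda>k u. 0"])

lemma x_J: "x k \<in> J"
proof -
  define c where "c l = (if l = k then (\<lambda>u::'x. u) else (\<lambda>u. 0))" for l
  have "x k u = (\<Sum>l\<in>UNIV. c l (x l u))" for u
  proof -
    have "(\<Sum>l\<in>UNIV. c l (x l u)) = (\<Sum>l\<in>UNIV. if l = k then x l u else 0)"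
      by (intro sum.cong) (auto simp: c_def)
    then show ?thesis by simp
  qed
  moreover have "c l \<in> R" for l by (auto simp: c_def R_id R_zero)
  ultimately show ?thesis unfolding J_def using x_in_R by blast
qed

lemma plus_J:
  assumes "f \<in> J" "g \<in> J" shows "(\<lambda>u. f u + g u) \<in> J"
proof -
  obtain c d where c: "\<forall>k. c k \<in> R" "\<forall>u\<in>X. f u = (\<Sum>k\<in>UNIV. c k (x k u))"
    and d: "\<forall>k. d k \<in> R" "\<forall>u\<in>X. g u = (\<Sum>k\<in>UNIV. d k (x k u))"
    using assms by (auto simp: J_def)
  have "\<forall>k. (\<lambda>u. c k u + d k u) \<in> R" using c d R_plus by blast
  moreover have "\<forall>u\<in>X. f u + g u = (\<Sum>k\<in>UNIV. (\<lambda>u. c k u + d k u) (x k u))"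
    using c d by (simp add: sum.distrib)
  ultimately have "\<exists>e. (\<forall>k. e k \<in> R) \<and> (\<forall>u\<in>X. f u + g u = (\<Sum>k\<in>UNIV. e k (x k u)))"
    by (intro exI[of _ "\<lambda>k u. c k u + d k u"]) simp
  then show ?thesis using R_plus[OF assms[THEN J_in_R]] by (simp add: J_def)
qed

lemma comp_J:
  assumes "f \<in> R" "g \<in> J" shows "(\<lambda>u. f (g u)) \<in> J"
proof -
  obtain c where c: "\<forall>k. c k \<in> R" "\<forall>u\<in>X. g u = (\<Sum>k\<in>UNIV. c k (x k u))"
    using assms by (auto simp: J_def)
  have "\<forall>k. (\<lambda>u. f (c k u)) \<in> R" using c assms R_comp by blast
  moreover have "\<forall>u\<in>X. f (g u) = (\<Sum>k\<in>UNIV. (\<lambda>u. f (c k u)) (x k u))"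
    using c by (simp add: R_sum[OF assms(1)] R_in x_in_R)
  ultimately have "\<exists>e. (\<forall>k. e k \<in> R) \<and> (\<forall>u\<in>X. f (g u) = (\<Sum>k\<in>UNIV. e k (x k u)))"
    by (intro exI[of _ "\<lambda>k u. f (c k u)"]) simp
  then show ?thesis using R_comp[OF assms(1) J_in_R[OF assms(2)]] by (simp add: J_def)
qed

lemma gen_in_J: "f \<in> gen_ops (x ` A) \<Longrightarrow> f \<in> J"
  by (induction rule: gen_ops.induct) (auto intro: zero_J x_J plus_J comp_J J_in_R)

fun regs :: "'x set \<Rightarrow> ('x \<Rightarrow> 'x) list \<Rightarrow> bool" where
  "regs K [] \<longleftrightarrow> True"
| "regs K (y # ys) \<longleftrightarrow> reg y K \<and> regs (ext K y) ys"

lemma regs_iff: "regs K ys \<longleftrightarrow> (\<forall>l<length ys. reg (ys ! l) (foldl ext K (take l ys)))"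
proof (induction ys arbitrary: K)
  case (Cons y ys)
  show ?case
    by (auto simp: Cons.IH less_Suc_eq_0_disj)
qed simp

lemma submod_foldl_ext: "submod K \<Longrightarrow> set ys \<subseteq> R \<Longrightarrow> submod (foldl ext K ys)"
  by (induction ys arbitrary: K) (auto intro: submod_ext)

text \<open>Depth of X/K with respect to \<open>J\<close>; properness of the last quotient is
  supplied separately by \<open>graded_nakayama\<close>.\<close>

definition depth_ge :: "nat \<Rightarrow> 'x set \<Rightarrow> bool" where
  "depth_ge d K \<longleftrightarrow> (\<exists>ys. length ys = d \<and> set ys \<subseteq> J \<and> regs K ys)"

lemma depth_ge_0: "depth_ge 0 K" by (simp add: depth_ge_def)

lemma depth_ge_Suc: "depth_ge (Suc d) K \<longleftrightarrow> (\<exists>y\<in>J. reg y K \<and> depth_ge d (ext K y))"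
proof
  assume "depth_ge (Suc d) K"
  then obtain ys where "length ys = Suc d" "set ys \<subseteq> J" "regs K ys" by (auto simp: depth_ge_def)
  then show "\<exists>y\<in>J. reg y K \<and> depth_ge d (ext K y)" by (cases ys) (auto simp: depth_ge_def)
next
  assume "\<exists>y\<in>J. reg y K \<and> depth_ge d (ext K y)"
  then obtain y ys where "y \<in> J" "reg y K" "length ys = d" "set ys \<subseteq> J" "regs (ext K y) ys"
    by (auto simp: depth_ge_def)
  then show "depth_ge (Suc d) K" unfolding depth_ge_def by (intro exI[of _ "y # ys"]) auto
qed

text \<open>An element of \<open>J\<close> is a combination of the variables, hence kills every
  socle element of X/K.\<close>

lemma reg_soc0:
  assumes K: "submod K" and y: "y \<in> J" "reg y K"
  shows "soc0 UNIV K"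
  unfolding soc0_def
proof (intro ballI impI)
  fix u assume u: "u \<in> X" "\<forall>k\<in>UNIV. x k u \<in> K"
  obtain c where "\<forall>k. c k \<in> R" "\<forall>u\<in>X. y u = (\<Sum>k\<in>UNIV. c k (x k u))"
    using y by (auto simp: J_def)
  then have "y u \<in> K" using u submod_combination[OF K, of UNIV c "\<lambda>k. x k u"] by simp
  then show "u \<in> K" using y u by (auto simp: reg_def)
qed

text \<open>The half of the permutability of regular sequences that holds without Nakayama: if g u =
  h v modulo \<open>K\<close>, regularity of \<open>h\<close> gives v = g w modulo K, and cancelling
  \<open>g\<close> leaves u = h w.\<close>

lemma reg_swap:
  assumes K: "submod K" and g: "g \<in> R" "reg g K" and h: "h \<in> R" "reg h (ext K g)"
  shows "reg g (ext K h)"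
  unfolding reg_def
proof (intro ballI impI)
  fix u assume u: "u \<in> X" "g u \<in> ext K h"
  then obtain k v where kv: "g u = k + h v" "k \<in> K" "v \<in> X" by (auto simp: ext_def)
  have "h v = (0 - k) + g u" using kv by simp
  moreover have "0 - k \<in> K" using submodD(2,3)[OF K] kv by blast
  ultimately have "h v \<in> ext K g" using extI[of "0 - k" K u g] u by simp
  then have "v \<in> ext K g" using h kv by (auto simp: reg_def)
  then obtain l w where lw: "v = l + g w" "l \<in> K" "w \<in> X" by (auto simp: ext_def)
  have hw: "h w \<in> X" using R_in h lw by blast
  have lX: "l \<in> X" using submodD(1)[OF K lw(2)] .
  have "h v = h l + g (h w)" unfolding lw(1) using R_add[OF h(1) lX R_in[OF g(1) lw(3)]] R_comm[OF h(1) g(1) lw(3)] by simp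
  then have "g (u - h w) = k + h l" using R_diff[OF g(1) u(1) hw] kv(1) by simp
  also have "\<dots> \<in> K" using submodD(4,5)[OF K] h lw kv by blast
  finally have "u - h w \<in> K" using g(2) X_diff[OF u(1) hw] by (auto simp: reg_def)
  then show "u \<in> ext K h" using extI[of "u - h w" K w h] lw(3) by simp
qed

text \<open>Behind this stands that the socle of X/K modulo a regular element of \<open>J\<close> is
  Ext^1(R/J, X/K), independent of that element. Explicitly, a socle element \<open>u\<close> modulo
  \<open>g\<close> corresponds to the \<open>v\<close> with f u = g v modulo \<open>K\<close>, which
  is a socle element modulo \<open>f\<close>.\<close>

lemma soc0_exchange:
  assumes K: "submod K" and f: "f \<in> J" "reg f K" and g: "g \<in> J" "reg g K"
    and s: "soc0 UNIV (ext K f)"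
  shows "soc0 UNIV (ext K g)"
  unfolding soc0_def
proof (intro ballI impI)
  fix u assume u: "u \<in> X" "\<forall>k\<in>UNIV. x k u \<in> ext K g"
  note fR = J_in_R[OF f(1)] and gR = J_in_R[OF g(1)]
  note Kg = submod_ext[OF K gR]
  obtain c where c: "\<forall>k. c k \<in> R" "\<forall>u\<in>X. f u = (\<Sum>k\<in>UNIV. c k (x k u))"
    using f by (auto simp: J_def)
  then have "f u \<in> ext K g" using u submod_combination[OF Kg, of UNIV c "\<lambda>k. x k u"] by simp
  then obtain l v where v: "f u = l + g v" "l \<in> K" "v \<in> X" by (auto simp: ext_def)
  \<comment> \<open>Evaluate \<open>f (x k u)\<close> through both \<open>f u = l + g v\<close> and
    \<open>x k u = m + g w\<close>, then cancel \<open>g\<close>.\<close>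
  have "x k v \<in> ext K f" for k
  proof -
    have "x k u \<in> ext K g" using u by blast
    then obtain m w where w: "x k u = m + g w" "m \<in> K" "w \<in> X" by (auto simp: ext_def)
    have wX: "f w \<in> X" "x k v \<in> X" and mX: "m \<in> X" and lX: "l \<in> X" and gX: "g v \<in> X" "g w \<in> X"
      using R_in[OF fR w(3)] R_in[OF x_in_R v(3)] submodD(1)[OF K] w v R_in[OF gR] by auto
    have "f (x k u) = f m + g (f w)"
      unfolding w(1) using R_add[OF fR mX gX(2)] R_comm[OF fR gR w(3)] by simp
    moreover have "f (x k u) = x k l + g (x k v)"
      using R_comm[OF fR x_in_R u(1)] v(1) R_add[OF x_in_R lX gX(1)] R_comm[OF x_in_R gR v(3)] by simp
    ultimately have "g (x k v) - g (f w) = f m - x k l" by (simp add: algebra_simps)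
    then have "g (x k v - f w) = f m - x k l" using R_diff[OF gR wX(2,1)] by simp
    also have "\<dots> \<in> K" using submodD(3,5)[OF K] fR x_in_R w v by blast
    finally have "x k v - f w \<in> K" using g(2) X_diff wX by (auto simp: reg_def)
    then show ?thesis using extI[of "x k v - f w" K w f] w(3) by simp
  qed
  then have "v \<in> ext K f" using s v(3) by (auto simp: soc0_def)
  then obtain m w where w: "v = m + f w" "m \<in> K" "w \<in> X" by (auto simp: ext_def)
  have mX: "m \<in> X" and fwX: "f w \<in> X" and gwX: "g w \<in> X"
    using submodD(1)[OF K w(2)] R_in[OF fR w(3)] R_in[OF gR w(3)] by auto
  have "g v = g m + f (g w)"
    unfolding w(1) using R_add[OF gR mX fwX] R_comm[OF gR fR w(3)] by simp
  then have "f (u - g w) = l + g m" using v(1) R_diff[OF fR u(1) gwX] by simp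
  also have "\<dots> \<in> K" using submodD(4,5)[OF K] gR w v by blast
  finally have "u - g w \<in> K" using f(2) X_diff[OF u(1) gwX] by (auto simp: reg_def)
  then show "u \<in> ext K g" using extI[of "u - g w" K w g] w(3) by simp
qed

text \<open>The induction passes from \<open>f\<close> to \<open>g\<close> through an element \<open>h\<close> that is regular modulo \<open>K\<close>, \<open>K + fX\<close>
  and \<open>K + gX\<close>.\<close>
lemma depth_ge_exchange:
  assumes "submod K" "depth_ge (Suc d) K" "g \<in> J" "reg g K"
  shows "depth_ge d (ext K g)"
  using assms
proof (induction d arbitrary: K g)
  case 0
  show ?case by (rule depth_ge_0)
next
  case (Suc d)
  note K = Suc.prems(1) and g = Suc.prems(3,4)
  note gR = J_in_R[OF g(1)]
  obtain f where f: "f \<in> J" "reg f K" and Df: "depth_ge (Suc d) (ext K f)"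
    using Suc.prems(2) depth_ge_Suc by blast
  note fR = J_in_R[OF f(1)]
  note Kf = submod_ext[OF K fR] and Kg = submod_ext[OF K gR]
  have sf: "soc0 UNIV (ext K f)" using Df reg_soc0[OF Kf] depth_ge_Suc by blast
  have sg: "soc0 UNIV (ext K g)" by (rule soc0_exchange[OF K f g sf])
  have s: "soc0 UNIV K" by (rule reg_soc0[OF K f])
  obtain h where h: "h \<in> gen_ops (x ` UNIV)" "\<forall>L\<in>{K, ext K f, ext K g}. reg h L"
    using ex_regular[of "{K, ext K f, ext K g}" UNIV] K Kf Kg s sf sg by blast
  have hJ: "h \<in> J" using gen_in_J[OF h(1)] .
  note hR = J_in_R[OF hJ]
  note Kh = submod_ext[OF K hR]
  \<comment> \<open>The induction hypothesis is used twice: for K + fX with \<open>h\<close>, and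
    then for K + hX with \<open>g\<close>, since \<open>f\<close> followed by the sequence just
    found has length d + 1 modulo K + hX. \<open>reg_swap\<close> keeps \<open>f\<close> and
    \<open>g\<close> regular modulo K + hX.\<close>
  have "depth_ge d (ext (ext K h) f)"
    using Suc.IH[OF Kf Df hJ] h(2) unfolding ext_commute[of K f h] by blast
  moreover have "reg f (ext K h)" using reg_swap[OF K fR f(2) hR] h(2) by blast
  ultimately have "depth_ge (Suc d) (ext K h)" unfolding depth_ge_Suc using f(1) by blast
  moreover have "reg g (ext K h)" using reg_swap[OF K gR g(2) hR] h(2) by blast
  ultimately have "depth_ge d (ext (ext K g) h)"
    using Suc.IH[OF Kh _ g(1)] unfolding ext_commute[of K g h] by blast
  then show ?case unfolding depth_ge_Suc using hJ h(2) by blast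
qed

section \<open>Sequences avoiding one variable\<close>

text \<open>Expanding \<open>f\<close> in the variables gives f u = x_i w modulo \<open>K\<close>
  with \<open>w = c i u\<close>. So \<open>w\<close> is a socle element modulo K + fX, which has
  zero socle by the depth assumption; hence w = f v modulo \<open>K\<close>, and cancelling
  \<open>f\<close> gives u = x_i v. Since \<open>v\<close> is of the same kind as \<open>u\<close>,
  the division can be repeated indefinitely.\<close>

lemma lift_through_x:
  assumes K: "submod K" and D2: "depth_ge (Suc (Suc d)) K" and u: "u \<in> X"
    and uk: "\<And>k. k \<noteq> i \<Longrightarrow> x k u \<in> K"
  shows "\<exists>v\<in>X. u - x i v \<in> K \<and> (\<forall>k. k \<noteq> i \<longrightarrow> x k v \<in> K)"
proof -
  obtain f where f: "f \<in> J" "reg f K" and Df: "depth_ge (Suc d) (ext K f)"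
    using D2 depth_ge_Suc by blast
  note fR = J_in_R[OF f(1)]
  note Kf = submod_ext[OF K fR]
  have sf: "soc0 UNIV (ext K f)" using Df reg_soc0[OF Kf] depth_ge_Suc by blast
  obtain c where c: "\<forall>k. c k \<in> R" "\<forall>u\<in>X. f u = (\<Sum>k\<in>UNIV. c k (x k u))"
    using f by (auto simp: J_def)
  define w where "w = c i u"
  have wX: "w \<in> X" using c u R_in by (auto simp: w_def)
  have "f u = c i (x i u) + (\<Sum>k\<in>UNIV - {i}. c k (x k u))"
    using c(2) u by (simp add: sum.remove[of UNIV i])
  moreover have rest: "(\<Sum>k\<in>UNIV - {i}. c k (x k u)) \<in> K"
    using c uk by (intro submod_combination[OF K]) auto
  moreover have "c i (x i u) = x i w" unfolding w_def using R_comm[OF _ x_in_R u] c by blast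
  ultimately obtain m where m: "f u = x i w + m" "m \<in> K" by metis
  have xk: "x k w \<in> K" if "k \<noteq> i" for k
    using R_comm[OF x_in_R _ u, of "c i" k] submodD(5)[OF K _ uk[OF that]] c by (simp add: w_def)
  have "x k w \<in> ext K f" for k
  proof (cases "k = i")
    case True
    have "x i w = (0 - m) + f u" using m by simp
    moreover have "0 - m \<in> K" using submodD(2,3)[OF K] m by blast
    ultimately show ?thesis using True u extI[of "0 - m" K u f] by simp
  next
    case False
    then show ?thesis using xk ext_left[OF fR] by blast
  qed
  then have "w \<in> ext K f" using sf wX by (auto simp: soc0_def)
  then obtain l v where v: "w = l + f v" "l \<in> K" "v \<in> X" by (auto simp: ext_def)
  have lX: "l \<in> X" and fvX: "f v \<in> X" and xvX: "x k v \<in> X" for k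
    using submodD(1)[OF K v(2)] R_in[OF fR v(3)] R_in[OF x_in_R v(3)] by auto
  have xw: "x k w = x k l + f (x k v)" for k
    unfolding v(1) using R_add[OF x_in_R lX fvX] R_comm[OF x_in_R fR v(3)] by simp
  have "f (u - x i v) = x i l + m"
    using R_diff[OF fR u xvX] m(1) xw[of i] by simp
  also have "\<dots> \<in> K" using submodD(4,5)[OF K] x_in_R v m by blast
  finally have "u - x i v \<in> K" using f(2) X_diff[OF u xvX] by (auto simp: reg_def)
  moreover have "x k v \<in> K" if "k \<noteq> i" for k
  proof -
    have "f (x k v) = x k w - x k l" using xw[of k] by simp
    also have "\<dots> \<in> K" using submodD(3,5)[OF K] x_in_R v xk[OF that] by blast
    finally show ?thesis using f(2) xvX by (auto simp: reg_def)
  qed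
  ultimately show ?thesis using v(3) by blast
qed

lemma lift_through_x_pow:
  assumes K: "submod K" and D2: "depth_ge (Suc (Suc d)) K" and u: "u \<in> X"
    and uk: "\<And>k. k \<noteq> i \<Longrightarrow> x k u \<in> K"
  shows "\<exists>v\<in>X. u - (x i ^^ N) v \<in> K \<and> (\<forall>k. k \<noteq> i \<longrightarrow> x k v \<in> K)"
proof (induction N)
  case 0
  then show ?case using u uk submodD(2)[OF K] by (auto intro!: bexI[of _ u])
next
  case (Suc N)
  then obtain v where v: "v \<in> X" "u - (x i ^^ N) v \<in> K" "\<And>k. k \<noteq> i \<Longrightarrow> x k v \<in> K" by blast
  obtain w where w: "w \<in> X" "v - x i w \<in> K" "\<And>k. k \<noteq> i \<Longrightarrow> x k w \<in> K"
    using lift_through_x[OF K D2 v(1,3)] by blast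
  note xN = R_funpow[OF x_in_R, of N i]
  have "(x i ^^ N) (v - x i w) \<in> K" using submodD(5)[OF K xN w(2)] .
  then have "(x i ^^ N) v - (x i ^^ Suc N) w \<in> K"
    using R_diff[OF xN v(1) R_in[OF x_in_R w(1)]] by (simp del: funpow.simps add: funpow_Suc_right)
  then have "(u - (x i ^^ N) v) + ((x i ^^ N) v - (x i ^^ Suc N) w) \<in> K"
    using submodD(4)[OF K v(2)] by blast
  then show ?case using w by (auto intro!: bexI[of _ w])
qed

text \<open>Meant for the truncations, which need not commute with x_i and so are out of reach of
  \<open>R_comm\<close>.\<close>

lemma gen_commute:
  assumes "f \<in> gen_ops (x ` A)" "u \<in> X"
    and "\<And>u. u \<in> X \<Longrightarrow> t u \<in> X" "\<And>u v. u \<in> X \<Longrightarrow> v \<in> X \<Longrightarrow> t (u + v) = t u + t v"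
    and "\<And>k u. k \<in> A \<Longrightarrow> u \<in> X \<Longrightarrow> t (x k u) = x k (t u)"
  shows "t (f u) = f (t u)"
  using assms(1,2)
proof (induction arbitrary: u)
  case gen_zero
  then show ?case using assms(4)[OF X_zero X_zero] by simp
next
  case (gen_plus f g)
  then have "f u \<in> X" "g u \<in> X" using R_in gen_in_J J_in_R by blast+
  then show ?case using gen_plus assms(4) by simp
next
  case (gen_comp f g)
  then have "g u \<in> X" using R_in gen_in_J J_in_R by blast
  then show ?case using gen_comp by simp
qed (use assms in auto)

text \<open>The truncations \<open>T\<close> stand for the projections onto the degrees bounded above in direction
  \<open>i\<close>; a submodule stable under them is homogeneous in that direction.\<close>
lemma regular_avoiding_variable:
  assumes T_in: "\<And>t u. t \<in> T \<Longrightarrow> u \<in> X \<Longrightarrow> t u \<in> X"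
    and T_add: "\<And>t u v. t \<in> T \<Longrightarrow> u \<in> X \<Longrightarrow> v \<in> X \<Longrightarrow> t (u + v) = t u + t v"
    and T_x: "\<And>t k u. t \<in> T \<Longrightarrow> k \<noteq> i \<Longrightarrow> u \<in> X \<Longrightarrow> t (x k u) = x k (t u)"
    and T_ex: "\<And>u. u \<in> X \<Longrightarrow> \<exists>t\<in>T. \<exists>N. t u = u \<and> (\<forall>v\<in>X. t ((x i ^^ N) v) = 0)"
    and K: "submod K" and TK: "\<And>t u. t \<in> T \<Longrightarrow> u \<in> K \<Longrightarrow> t u \<in> K" and D: "depth_ge (Suc d) K"
  shows "\<exists>ys. length ys = d \<and> set ys \<subseteq> gen_ops (x ` (- {i})) \<and> regs K ys \<and> soc0 UNIV (foldl ext K ys)"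
  using K TK D
proof (induction d arbitrary: K)
  case 0
  then show ?case using reg_soc0 by (auto simp: depth_ge_Suc)
next
  case (Suc d)
  note K = Suc.prems(1)
  \<comment> \<open>Modulo \<open>K\<close>, \<open>u\<close> is divisible by every power of x_i,
    while some truncation fixes \<open>u\<close> and kills the multiples of a high power; as
    \<open>K\<close> is stable under it, \<open>u\<close> lies in \<open>K\<close>.\<close>
  have "soc0 (- {i}) K"
    unfolding soc0_def
  proof (intro ballI impI)
    fix u assume u: "u \<in> X" "\<forall>k\<in>- {i}. x k u \<in> K"
    obtain t N where t: "t \<in> T" "t u = u" "\<forall>v\<in>X. t ((x i ^^ N) v) = 0" using T_ex[OF u(1)] by blast
    obtain v where v: "v \<in> X" "u - (x i ^^ N) v \<in> K"
      using lift_through_x_pow[OF K Suc.prems(3) u(1)] u(2) by blast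
    have xv: "(x i ^^ N) v \<in> X" using R_in[OF R_funpow[OF x_in_R] v(1)] .
    have "t u = t (u - (x i ^^ N) v) + t ((x i ^^ N) v)"
      using T_add[OF t(1) X_diff[OF u(1) xv] xv] by simp
    then show "u \<in> K" using t v Suc.prems(2)[OF t(1) v(2)] by simp
  qed
  then obtain y where y: "y \<in> gen_ops (x ` (- {i}))" "reg y K"
    using ex_regular[of "{K}" "- {i}"] K by blast
  have yJ: "y \<in> J" using gen_in_J[OF y(1)] .
  have "\<exists>ys. length ys = d \<and> set ys \<subseteq> gen_ops (x ` (- {i})) \<and> regs (ext K y) ys
      \<and> soc0 UNIV (foldl ext (ext K y) ys)"
  proof (rule Suc.IH)
    show "submod (ext K y)" using submod_ext[OF K J_in_R[OF yJ]] .
    show "depth_ge (Suc d) (ext K y)" using depth_ge_exchange[OF K Suc.prems(3) yJ y(2)] .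
    \<comment> \<open>Stability under truncations passes to K + yX because \<open>y\<close> avoids
      x_i.\<close>
    fix t a assume t: "t \<in> T" "a \<in> ext K y"
    then obtain k u where a: "a = k + y u" "k \<in> K" "u \<in> X" by (auto simp: ext_def)
    have "t a = t k + t (y u)"
      unfolding a(1) using T_add[OF t(1)] submodD(1)[OF K a(2)] R_in[OF J_in_R[OF yJ] a(3)] by blast
    also have "t (y u) = y (t u)"
      by (rule gen_commute[OF y(1) a(3)]) (use t T_in T_add T_x in auto)
    finally show "t a \<in> ext K y"
      using extI[OF Suc.prems(2)[OF t(1) a(2)] T_in[OF t(1) a(3)]] by simp
  qed
  then obtain ys where "length ys = d" "set ys \<subseteq> gen_ops (x ` (- {i}))" "regs (ext K y) ys"
      "soc0 UNIV (foldl ext (ext K y) ys)" by blast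
  then show ?case using y by (intro exI[of _ "y # ys"]) auto
qed

end

section \<open>Multigraded modules and the action of polynomials\<close>

lemma sum_fun_apply: "(\<Sum>a\<in>I. f a) c = (\<Sum>a\<in>I. f a c)"
  by (induction I rule: infinite_finite_induct) auto

lemma nonneg_add: "nonneg a \<Longrightarrow> nonneg b \<Longrightarrow> nonneg (a + b)"
  by (auto simp: nonneg_def)

lemma nonneg_zero [simp]: "nonneg 0"
  by (auto simp: nonneg_def)

lemma nonneg_axis [simp]: "nonneg (axis k 1)"
  by (auto simp: nonneg_def axis_def)

locale graded_mod =
  fixes sc :: "'k::field \<Rightarrow> 'v::ab_group_add \<Rightarrow> 'v"
    and M :: "int ^ 'n::finite \<Rightarrow> 'v set"
    and mu :: "int ^ 'n \<Rightarrow> int ^ 'n \<Rightarrow> 'v \<Rightarrow> 'v"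
  assumes gm: "graded_module sc M mu"
begin

sublocale vs: vector_space sc
  using gm by (simp add: graded_module_def)

lemma subspace_M: "vs.subspace (M a)"
  using gm by (simp add: graded_module_def)

lemmas M_0 = vs.subspace_0[OF subspace_M]
  and M_add = vs.subspace_add[OF subspace_M]
  and M_scale = vs.subspace_scale[OF subspace_M]

lemma mu_in: "nonneg b \<Longrightarrow> v \<in> M a \<Longrightarrow> mu a b v \<in> M (a + b)"
  and mu_add: "nonneg b \<Longrightarrow> v \<in> M a \<Longrightarrow> w \<in> M a \<Longrightarrow> mu a b (v + w) = mu a b v + mu a b w"
  and mu_sc: "nonneg b \<Longrightarrow> v \<in> M a \<Longrightarrow> mu a b (sc t v) = sc t (mu a b v)"
  and mu_id: "v \<in> M a \<Longrightarrow> mu a 0 v = v"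
  and mu_mu: "nonneg b \<Longrightarrow> nonneg c \<Longrightarrow> v \<in> M a \<Longrightarrow> mu (a + b) c (mu a b v) = mu a (b + c) v"
  using gm by (simp_all add: graded_module_def)

lemma mu_0: "nonneg b \<Longrightarrow> mu a b 0 = 0"
  using mu_sc[of b 0 a 0] M_0 by simp

lemma mu_mu': "nonneg b \<Longrightarrow> nonneg c \<Longrightarrow> v \<in> M a \<Longrightarrow> a' = a + b \<Longrightarrow> mu a' c (mu a b v) = mu a (b + c) v"
  using mu_mu by simp

definition X :: "(int ^ 'n \<Rightarrow> 'v) set" where "X = Collect (module_elem M)"

definition psc :: "'k \<Rightarrow> (int ^ 'n \<Rightarrow> 'v) \<Rightarrow> int ^ 'n \<Rightarrow> 'v" where
  "psc t u = (\<lambda>c. sc t (u c))"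

definition mon :: "int ^ 'n \<Rightarrow> (int ^ 'n \<Rightarrow> 'v) \<Rightarrow> int ^ 'n \<Rightarrow> 'v" where
  "mon b u = (\<lambda>c. mu (c - b) b (u (c - b)))"

abbreviation act :: "(int ^ 'n \<Rightarrow> 'k) \<Rightarrow> (int ^ 'n \<Rightarrow> 'v) \<Rightarrow> int ^ 'n \<Rightarrow> 'v" where
  "act \<equiv> pact sc mu"

sublocale fs: vector_space psc
  by standard (auto simp: psc_def vs.scale_right_distrib vs.scale_left_distrib fun_eq_iff)

lemma X_comp: "u \<in> X \<Longrightarrow> u c \<in> M c"
  by (simp add: X_def module_elem_def)

lemma X_I: "finite S \<Longrightarrow> (\<And>c. c \<notin> S \<Longrightarrow> u c = 0) \<Longrightarrow> (\<And>c. u c \<in> M c) \<Longrightarrow> u \<in> X"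
  unfolding X_def module_elem_def by (auto intro: finite_subset[of _ S])

lemma X_finite: "u \<in> X \<Longrightarrow> finite {c. u c \<noteq> 0}"
  by (simp add: X_def module_elem_def)

lemma subspace_X: "fs.subspace X"
proof (rule fs.subspaceI)
  show "0 \<in> X" by (rule X_I[of "{}"]) (auto simp: M_0)
  show "u + v \<in> X" if "u \<in> X" "v \<in> X" for u v
    by (rule X_I[of "{c. u c \<noteq> 0} \<union> {c. v c \<noteq> 0}"])
      (use that in \<open>auto simp: X_finite X_comp M_add\<close>)
  show "psc t u \<in> X" if "u \<in> X" for t u
    by (rule X_I[of "{c. u c \<noteq> 0}"]) (use that in \<open>auto simp: psc_def X_finite X_comp M_scale\<close>)
qed

lemmas X_0 = fs.subspace_0[OF subspace_X]
  and X_add = fs.subspace_add[OF subspace_X]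
  and X_diff = fs.subspace_diff[OF subspace_X]
  and X_psc = fs.subspace_scale[OF subspace_X]
  and X_sum = fs.subspace_sum[OF subspace_X]

lemma mon_in: "nonneg b \<Longrightarrow> u \<in> X \<Longrightarrow> mon b u \<in> X"
proof (rule X_I[of "(\<lambda>c. c + b) ` {c. u c \<noteq> 0}"])
  assume b: "nonneg b" and u: "u \<in> X"
  show "finite ((\<lambda>c. c + b) ` {c. u c \<noteq> 0})" using X_finite[OF u] by simp
  show "mon b u c \<in> M c" for c
    using mu_in[OF b X_comp[OF u, of "c - b"]] by (simp add: mon_def)
  fix c assume "c \<notin> (\<lambda>c. c + b) ` {c. u c \<noteq> 0}"
  then have "u (c - b) = 0" by (metis (mono_tags, lifting) diff_add_cancel imageI mem_Collect_eq)
  then show "mon b u c = 0" using mu_0[OF b] by (simp add: mon_def)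
qed

lemma mon_add: "nonneg b \<Longrightarrow> u \<in> X \<Longrightarrow> v \<in> X \<Longrightarrow> mon b (u + v) = mon b u + mon b v"
  by (auto simp: mon_def fun_eq_iff mu_add X_comp)

lemma mon_psc: "nonneg b \<Longrightarrow> u \<in> X \<Longrightarrow> mon b (psc t u) = psc t (mon b u)"
  by (auto simp: mon_def psc_def fun_eq_iff mu_sc X_comp)

lemma mon_zero: "nonneg b \<Longrightarrow> mon b 0 = 0"
  by (auto simp: mon_def fun_eq_iff mu_0)

lemma mon_sum: "nonneg b \<Longrightarrow> (\<And>a. a \<in> I \<Longrightarrow> f a \<in> X) \<Longrightarrow> mon b (sum f I) = (\<Sum>a\<in>I. mon b (f a))"
  by (induction I rule: infinite_finite_induct) (auto simp: mon_zero mon_add X_sum)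

lemma mon_id: "u \<in> X \<Longrightarrow> mon 0 u = u"
  by (auto simp: mon_def fun_eq_iff mu_id X_comp)

lemma mon_mon: "nonneg b \<Longrightarrow> nonneg b' \<Longrightarrow> u \<in> X \<Longrightarrow> mon b (mon b' u) = mon (b + b') u"
proof
  fix c assume b: "nonneg b" "nonneg b'" and u: "u \<in> X"
  have "mu (c - b) b (mu (c - b - b') b' (u (c - b - b'))) = mu (c - b - b') (b' + b) (u (c - b - b'))"
    by (rule mu_mu') (use b X_comp[OF u] in auto)
  then show "mon b (mon b' u) c = mon (b + b') u c"
    by (simp add: mon_def algebra_simps)
qed

text \<open>Any finite set containing the support is allowed, so that two polynomials can be summed
  over one index set.\<close>

lemma act_eq:
  assumes "finite F" "{b. f b \<noteq> 0} \<subseteq> F"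
  shows "act f u = (\<Sum>b\<in>F. psc (f b) (mon b u))"
proof
  fix c
  have "act f u c = (\<Sum>b\<in>{b. f b \<noteq> 0}. psc (f b) (mon b u) c)"
    by (simp add: pact_def psc_def mon_def)
  also have "\<dots> = (\<Sum>b\<in>F. psc (f b) (mon b u) c)"
    by (rule sum.mono_neutral_left) (use assms in \<open>auto simp: psc_def\<close>)
  finally show "act f u c = (\<Sum>b\<in>F. psc (f b) (mon b u)) c" by (simp add: sum_fun_apply)
qed

text \<open>\<open>S\<close> records which monomials may occur: \<open>NN\<close> gives the whole
  ring, \<open>exps A\<close> the polynomials without constant term in the variables of
  \<open>A\<close>. The polynomial is only asserted to exist, since different ones may act alike on
  \<open>X\<close>.\<close>

definition poly_op :: "(int ^ 'n) set \<Rightarrow> ((int ^ 'n \<Rightarrow> 'v) \<Rightarrow> int ^ 'n \<Rightarrow> 'v) \<Rightarrow> bool" where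
  "poly_op S r \<longleftrightarrow> (\<exists>f. finite {b. f b \<noteq> 0} \<and> {b. f b \<noteq> 0} \<subseteq> S \<and> (\<forall>u\<in>X. r u = act f u))"

lemma poly_op_zero: "poly_op S (\<lambda>u. 0)"
  unfolding poly_op_def by (rule exI[of _ "\<lambda>b. 0"]) (simp add: pact_def fun_eq_iff)

lemma poly_op_cong: "poly_op S r \<Longrightarrow> (\<And>u. u \<in> X \<Longrightarrow> r' u = r u) \<Longrightarrow> poly_op S r'"
  unfolding poly_op_def by auto

lemma poly_op_plus:
  assumes "poly_op S r" "poly_op S s" shows "poly_op S (\<lambda>u. r u + s u)"
proof -
  obtain f g where f: "finite {b. f b \<noteq> 0}" "{b. f b \<noteq> 0} \<subseteq> S" "\<forall>u\<in>X. r u = act f u"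
    and g: "finite {b. g b \<noteq> 0}" "{b. g b \<noteq> 0} \<subseteq> S" "\<forall>u\<in>X. s u = act g u"
    using assms by (auto simp: poly_op_def)
  let ?F = "{b. f b \<noteq> 0} \<union> {b. g b \<noteq> 0}"
  have F: "finite ?F" using f g by simp
  have sub: "{b. f b + g b \<noteq> 0} \<subseteq> ?F" by auto
  have "act (\<lambda>b. f b + g b) u = act f u + act g u" for u
    unfolding act_eq[OF F sub] act_eq[OF F, of f, simplified] act_eq[OF F, of g, simplified]
    by (simp add: fs.scale_left_distrib sum.distrib)
  then show ?thesis unfolding poly_op_def
    using f g finite_subset[OF sub F] sub by (intro exI[of _ "\<lambda>b. f b + g b"]) auto
qed

lemma poly_op_psc:
  assumes "poly_op S r" shows "poly_op S (\<lambda>u. psc t (r u))"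
proof -
  obtain f where f: "finite {b. f b \<noteq> 0}" "{b. f b \<noteq> 0} \<subseteq> S" "\<forall>u\<in>X. r u = act f u"
    using assms by (auto simp: poly_op_def)
  have sub: "{b. t * f b \<noteq> 0} \<subseteq> {b. f b \<noteq> 0}" by auto
  have "act (\<lambda>b. t * f b) u = psc t (act f u)" for u
    unfolding act_eq[OF f(1) sub] act_eq[OF f(1) order.refl]
    by (simp add: fs.scale_sum_right)
  then show ?thesis unfolding poly_op_def
    using f finite_subset[OF sub f(1)] by (intro exI[of _ "\<lambda>b. t * f b"]) auto
qed

lemma poly_op_sum: "(\<And>a. a \<in> I \<Longrightarrow> poly_op S (r a)) \<Longrightarrow> poly_op S (\<lambda>u. \<Sum>a\<in>I. r a u)"
  by (induction I rule: infinite_finite_induct) (auto simp: poly_op_zero poly_op_plus)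

lemma act_monomial: "act (\<lambda>c. if c = b then 1 else 0) = mon b"
  by (rule ext) (simp add: act_eq[of "{b}"])

lemma poly_op_mon: "b \<in> S \<Longrightarrow> poly_op S (mon b)"
  unfolding poly_op_def by (rule exI[of _ "\<lambda>c. if c = b then 1 else 0"]) (auto simp: act_monomial)

lemma poly_op_act: "finite {b. f b \<noteq> 0} \<Longrightarrow> {b. f b \<noteq> 0} \<subseteq> S \<Longrightarrow> poly_op S (act f)"
  by (auto simp: poly_op_def)

lemma poly_op_expand:
  assumes "poly_op S r"
  obtains f where "finite {b. f b \<noteq> 0}" "{b. f b \<noteq> 0} \<subseteq> S"
    "\<And>u. u \<in> X \<Longrightarrow> r u = (\<Sum>b\<in>{b. f b \<noteq> 0}. psc (f b) (mon b u))"
proof -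
  obtain f where f: "finite {b. f b \<noteq> 0}" "{b. f b \<noteq> 0} \<subseteq> S" "\<forall>u\<in>X. r u = act f u"
    using assms by (auto simp: poly_op_def)
  show thesis by (rule that[OF f(1,2)]) (simp add: f(3) act_eq[OF f(1) order.refl])
qed

abbreviation "NN \<equiv> Collect (nonneg :: int ^ 'n \<Rightarrow> bool)"

lemma poly_op_in: "poly_op NN r \<Longrightarrow> u \<in> X \<Longrightarrow> r u \<in> X"
  by (erule poly_op_expand) (auto intro!: X_sum X_psc mon_in)

lemma poly_op_add: "poly_op NN r \<Longrightarrow> u \<in> X \<Longrightarrow> v \<in> X \<Longrightarrow> r (u + v) = r u + r v"
proof (erule poly_op_expand)
  fix f assume f: "{b. f b \<noteq> 0} \<subseteq> NN" and uv: "u \<in> X" "v \<in> X"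
    and r: "\<And>u. u \<in> X \<Longrightarrow> r u = (\<Sum>b\<in>{b. f b \<noteq> 0}. psc (f b) (mon b u))"
  have "r (u + v) = (\<Sum>b\<in>{b. f b \<noteq> 0}. psc (f b) (mon b u) + psc (f b) (mon b v))"
    unfolding r[OF X_add[OF uv]]
    by (intro sum.cong) (use f uv in \<open>auto simp: mon_add fs.scale_right_distrib\<close>)
  then show ?thesis by (simp add: sum.distrib r uv)
qed

lemma poly_op_zero_arg: "poly_op NN r \<Longrightarrow> r 0 = 0"
  using poly_op_add[OF _ X_0 X_0, of r] by (metis add_0 add_cancel_right_right)

lemma poly_op_sum_arg:
  "poly_op NN r \<Longrightarrow> (\<And>a. a \<in> I \<Longrightarrow> f a \<in> X) \<Longrightarrow> r (sum f I) = (\<Sum>a\<in>I. r (f a))"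
  by (induction I rule: infinite_finite_induct) (auto simp: poly_op_zero_arg poly_op_add X_sum)

lemma poly_op_psc_arg: "poly_op NN r \<Longrightarrow> u \<in> X \<Longrightarrow> r (psc t u) = psc t (r u)"
proof (erule poly_op_expand)
  fix f assume f: "{b. f b \<noteq> 0} \<subseteq> NN" and u: "u \<in> X"
    and r: "\<And>u. u \<in> X \<Longrightarrow> r u = (\<Sum>b\<in>{b. f b \<noteq> 0}. psc (f b) (mon b u))"
  have "psc (f b) (mon b (psc t u)) = psc t (psc (f b) (mon b u))" if "f b \<noteq> 0" for b
    using that f u by (auto simp: mon_psc mult.commute)
  then show ?thesis unfolding r[OF X_psc[OF u]] r[OF u] fs.scale_sum_right
    by (intro sum.cong) auto
qed

lemma poly_op_mon_comm:
  assumes "poly_op NN r" "nonneg b" "u \<in> X" shows "mon b (r u) = r (mon b u)"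
proof -
  obtain f where f: "{b. f b \<noteq> 0} \<subseteq> NN"
    and r: "\<And>u. u \<in> X \<Longrightarrow> r u = (\<Sum>b\<in>{b. f b \<noteq> 0}. psc (f b) (mon b u))"
    using assms(1) by (rule poly_op_expand) blast
  show ?thesis unfolding r[OF assms(3)] r[OF mon_in[OF assms(2,3)]]
    by (subst mon_sum[OF assms(2)])
      (use f assms in \<open>auto intro!: sum.cong X_psc mon_in simp: mon_psc mon_in mon_mon add.commute\<close>)
qed

lemma poly_op_comm:
  assumes r: "poly_op NN r" and "poly_op NN s" and u: "u \<in> X" shows "s (r u) = r (s u)"
proof -
  obtain f where f: "{b. f b \<noteq> 0} \<subseteq> NN"
    and s: "\<And>u. u \<in> X \<Longrightarrow> s u = (\<Sum>b\<in>{b. f b \<noteq> 0}. psc (f b) (mon b u))"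
    using assms(2) by (rule poly_op_expand) blast
  have "r (s u) = (\<Sum>b\<in>{b. f b \<noteq> 0}. r (psc (f b) (mon b u)))"
    unfolding s[OF u] using f u by (intro poly_op_sum_arg[OF r] X_psc mon_in) auto
  also have "\<dots> = (\<Sum>b\<in>{b. f b \<noteq> 0}. psc (f b) (mon b (r u)))"
    using f u by (intro sum.cong refl) (auto simp: poly_op_psc_arg[OF r] mon_in poly_op_mon_comm[OF r])
  finally show ?thesis using s[OF poly_op_in[OF r u]] by simp
qed

lemma poly_op_mon_comp:
  assumes r: "poly_op S r" and S: "S \<subseteq> NN" and b: "nonneg b" and S': "\<And>a. a \<in> S \<Longrightarrow> b + a \<in> S'"
  shows "poly_op S' (\<lambda>u. mon b (r u))"
proof -
  obtain f where f: "{b. f b \<noteq> 0} \<subseteq> S"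
    and r: "\<And>u. u \<in> X \<Longrightarrow> r u = (\<Sum>b\<in>{b. f b \<noteq> 0}. psc (f b) (mon b u))"
    using r by (rule poly_op_expand) blast
  have "poly_op S' (\<lambda>u. \<Sum>a\<in>{a. f a \<noteq> 0}. psc (f a) (mon (b + a) u))"
    using f S' by (intro poly_op_sum poly_op_psc poly_op_mon) auto
  then show ?thesis
  proof (rule poly_op_cong)
    fix u assume u: "u \<in> X"
    have nn: "nonneg a" if "f a \<noteq> 0" for a using that f S by auto
    have "mon b (r u) = (\<Sum>a\<in>{a. f a \<noteq> 0}. mon b (psc (f a) (mon a u)))"
      unfolding r[OF u] using nn u by (intro mon_sum[OF b] X_psc mon_in) auto
    also have "\<dots> = (\<Sum>a\<in>{a. f a \<noteq> 0}. psc (f a) (mon (b + a) u))"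
      using nn u b by (intro sum.cong refl) (auto simp: mon_psc mon_in mon_mon)
    finally show "mon b (r u) = (\<Sum>a\<in>{a. f a \<noteq> 0}. psc (f a) (mon (b + a) u))" .
  qed
qed

lemma poly_op_comp:
  assumes r: "poly_op S r" and s: "poly_op S' s" and SS: "S \<subseteq> NN" "S' \<subseteq> NN"
    and S'': "\<And>a b. a \<in> S \<Longrightarrow> b \<in> S' \<Longrightarrow> a + b \<in> S''"
  shows "poly_op S'' (\<lambda>u. r (s u))"
proof -
  obtain f where f: "{b. f b \<noteq> 0} \<subseteq> S"
    and r: "\<And>u. u \<in> X \<Longrightarrow> r u = (\<Sum>b\<in>{b. f b \<noteq> 0}. psc (f b) (mon b u))"
    using r by (rule poly_op_expand) blast
  have s': "poly_op NN s" using s SS(2) unfolding poly_op_def by blast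
  have "poly_op S'' (\<lambda>u. \<Sum>b\<in>{b. f b \<noteq> 0}. psc (f b) (mon b (s u)))"
    using f SS S'' by (intro poly_op_sum poly_op_psc poly_op_mon_comp[OF s]) auto
  then show ?thesis
    by (rule poly_op_cong) (simp add: r poly_op_in[OF s'])
qed

end

section \<open>Noetherianity\<close>

lemma mono_subseq:
  fixes f :: "nat \<Rightarrow> nat"
  shows "\<exists>r :: nat \<Rightarrow> nat. strict_mono r \<and> (\<forall>m n. m \<le> n \<longrightarrow> f (r m) \<le> f (r n))"
proof -
  obtain r :: "nat \<Rightarrow> nat" where r: "strict_mono r" "monoseq (\<lambda>n. f (r n))"
    using seq_monosub by blast
  show ?thesis
  proof (cases "\<forall>m n. m \<le> n \<longrightarrow> f (r m) \<le> f (r n)")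
    case True
    then show ?thesis using r by blast
  next
    case False
    then have dec: "m \<le> n \<Longrightarrow> f (r n) \<le> f (r m)" for m n
      using r(2) by (auto simp: monoseq_def)
    \<comment> \<open>A weakly decreasing sequence of naturals is constant from the place
      \<open>n0\<close> of its minimum on.\<close>
    obtain n0 where n0: "\<And>n. f (r n0) \<le> f (r n)"
      using ex_has_least_nat[of "\<lambda>_. True" 0 "\<lambda>n. f (r n)"] by auto
    show ?thesis
    proof (intro exI conjI allI impI)
      show "strict_mono (\<lambda>n. r (n + n0))" using r(1) by (simp add: strict_mono_def)
      fix m n
      show "f (r (m + n0)) \<le> f (r (n + n0))"
        using dec[of n0 "m + n0"] n0[of "n + n0"] by simp
    qed
  qed
qed

text \<open>The subsequence is refined for one coordinate after another; monotonicity already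
  achieved survives a further refinement.\<close>

lemma dickson_subseq:
  fixes s :: "nat \<Rightarrow> int ^ 'n::finite"
  assumes "\<And>n. nonneg (s n)"
  shows "\<exists>r :: nat \<Rightarrow> nat. strict_mono r \<and> (\<forall>k\<in>A. \<forall>m n. m \<le> n \<longrightarrow> s (r m) $ k \<le> s (r n) $ k)"
  using finite[of A]
proof (induction A rule: finite_induct)
  case empty
  show ?case by (rule exI[of _ id]) (simp add: strict_mono_def)
next
  case (insert a A)
  then obtain r :: "nat \<Rightarrow> nat" where r: "strict_mono r" "\<forall>k\<in>A. \<forall>m n. m \<le> n \<longrightarrow> s (r m) $ k \<le> s (r n) $ k"
    by blast
  obtain q :: "nat \<Rightarrow> nat" where q: "strict_mono q"
    "\<forall>m n. m \<le> n \<longrightarrow> nat (s (r (q m)) $ a) \<le> nat (s (r (q n)) $ a)"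
    using mono_subseq[of "\<lambda>n. nat (s (r n) $ a)"] by blast
  have qm: "m \<le> n \<Longrightarrow> q m \<le> q n" for m n using q(1) by (simp add: strict_mono_less_eq)
  show ?case
  proof (intro exI conjI ballI allI impI)
    show "strict_mono (r \<circ> q)" using r(1) q(1) by (rule strict_mono_o)
    fix k m n assume k: "k \<in> insert a A" and mn: "m \<le> (n::nat)"
    show "s ((r \<circ> q) m) $ k \<le> s ((r \<circ> q) n) $ k"
    proof (cases "k = a")
      case True
      then show ?thesis using q(2) mn assms[of "r (q n)"] by (force simp: nonneg_def nat_le_eq_zle)
    next
      case False
      then show ?thesis using k r(2) qm[OF mn] by auto
    qed
  qed
qed

lemma dickson:
  fixes s :: "nat \<Rightarrow> nat \<times> (int ^ 'n::finite)"
  assumes s: "\<And>n. fst (s n) < N" "\<And>n. nonneg (snd (s n))"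
  shows "\<exists>m n. m < n \<and> fst (s m) = fst (s n) \<and> nonneg (snd (s n) - snd (s m))"
proof -
  have "finite (range (\<lambda>n. fst (s n)))" using s(1) by (auto intro: finite_subset[of _ "{..<N}"])
  then obtain n0 where "infinite {n \<in> UNIV. fst (s n) = fst (s n0)}"
    using pigeonhole_infinite[of UNIV "\<lambda>n. fst (s n)"] by auto
  then obtain q :: "nat \<Rightarrow> nat" where q: "strict_mono q" "\<And>n. fst (s (q n)) = fst (s n0)"
    using infinite_enumerate[of "{n. fst (s n) = fst (s n0)}"] by auto
  obtain r :: "nat \<Rightarrow> nat" where r: "strict_mono r"
    "\<forall>k\<in>UNIV. \<forall>m n. m \<le> n \<longrightarrow> snd (s (q (r m))) $ k \<le> snd (s (q (r n))) $ k"
    using dickson_subseq[of "\<lambda>n. snd (s (q n))" UNIV] s(2) by blast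
  have "q (r 0) < q (r 1)" using q(1) r(1) by (simp add: strict_mono_less)
  then show ?thesis using r(2) q(2)
    by (intro exI[of _ "q (r 0)"] exI[of _ "q (r 1)"]) (auto simp: nonneg_def)
qed

text \<open>A monomial order on pairs of a generator index and an exponent: position over term,
  lexicographic in the exponents. The variables carry no order of their own; an injection
  \<open>e\<close> into the naturals supplies it.\<close>

definition mless :: "('n \<Rightarrow> nat) \<Rightarrow> nat \<times> (int ^ 'n::finite) \<Rightarrow> nat \<times> (int ^ 'n) \<Rightarrow> bool" where
  "mless e \<alpha> \<beta> \<longleftrightarrow> fst \<alpha> < fst \<beta> \<or> fst \<alpha> = fst \<beta> \<and>
     (\<exists>k. snd \<alpha> $ k < snd \<beta> $ k \<and> (\<forall>l. e l < e k \<longrightarrow> snd \<alpha> $ l = snd \<beta> $ l))"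

lemma mless_trans:
  assumes "inj e" "mless e \<alpha> \<beta>" "mless e \<beta> \<gamma>" shows "mless e \<alpha> \<gamma>"
proof (cases "fst \<alpha> = fst \<beta> \<and> fst \<beta> = fst \<gamma>")
  case False
  then show ?thesis using assms(2,3) by (auto simp: mless_def)
next
  case True
  then obtain k l where k: "snd \<alpha> $ k < snd \<beta> $ k" "\<forall>j. e j < e k \<longrightarrow> snd \<alpha> $ j = snd \<beta> $ j"
    and l: "snd \<beta> $ l < snd \<gamma> $ l" "\<forall>j. e j < e l \<longrightarrow> snd \<beta> $ j = snd \<gamma> $ j"
    using assms(2,3) by (auto simp: mless_def)
  consider "e k < e l" | "k = l" | "e l < e k"
    using assms(1) by (metis injD linorder_neqE_nat)
  then have "\<exists>k. snd \<alpha> $ k < snd \<gamma> $ k \<and> (\<forall>l. e l < e k \<longrightarrow> snd \<alpha> $ l = snd \<gamma> $ l)"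
  proof cases
    case 1
    then show ?thesis using k l by (intro exI[of _ k]) auto
  next
    case 2
    then show ?thesis using k l by (intro exI[of _ k]) auto
  next
    case 3
    then show ?thesis using k l by (intro exI[of _ l]) auto
  qed
  then show ?thesis using True by (auto simp: mless_def)
qed

lemma mless_total:
  assumes "inj e" "\<alpha> \<noteq> \<beta>" shows "mless e \<alpha> \<beta> \<or> mless e \<beta> \<alpha>"
proof (cases "fst \<alpha> = fst \<beta>")
  case False
  then show ?thesis by (auto simp: mless_def)
next
  case True
  then have "\<exists>k. snd \<alpha> $ k \<noteq> snd \<beta> $ k" using assms(2) by (auto simp: prod_eq_iff vec_eq_iff)
  then obtain k where k: "snd \<alpha> $ k \<noteq> snd \<beta> $ k"
    and least: "\<And>l. snd \<alpha> $ l \<noteq> snd \<beta> $ l \<Longrightarrow> e k \<le> e l"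
    using ex_has_least_nat[of "\<lambda>k. snd \<alpha> $ k \<noteq> snd \<beta> $ k" _ e] by blast
  have eq: "snd \<alpha> $ l = snd \<beta> $ l" if "e l < e k" for l
    using least[of l] that by force
  consider "snd \<alpha> $ k < snd \<beta> $ k" | "snd \<beta> $ k < snd \<alpha> $ k" using k by linarith
  then show ?thesis using True eq unfolding mless_def by cases metis+
qed

lemma mless_not_ge: "fst \<alpha> = fst \<beta> \<Longrightarrow> nonneg (snd \<beta> - snd \<alpha>) \<Longrightarrow> \<not> mless e \<beta> \<alpha>"
  by (auto simp: mless_def nonneg_def not_less)

lemma mless_shift: "mless e (g, a) (h, b) \<Longrightarrow> mless e (g, a + c) (h, b + c)"
  by (auto simp: mless_def)

text \<open>In a descending chain Dickson's lemma finds a term dividing a later one, and a multiple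
  is never smaller.\<close>

lemma mless_wf:
  assumes "inj e"
  shows "wf {(\<alpha>, \<beta>). \<alpha> \<in> {..<N} \<times> Collect nonneg \<and> \<beta> \<in> {..<N} \<times> Collect nonneg \<and> mless e \<alpha> \<beta>}"
  unfolding wf_iff_no_infinite_down_chain
proof
  assume "\<exists>f. \<forall>i. (f (Suc i), f i) \<in> {(\<alpha>, \<beta>). \<alpha> \<in> {..<N} \<times> Collect nonneg \<and> \<beta> \<in> {..<N} \<times> Collect nonneg \<and> mless e \<alpha> \<beta>}"
  then obtain f where "\<forall>i. (f (Suc i), f i) \<in> {(\<alpha>, \<beta>). \<alpha> \<in> {..<N} \<times> Collect nonneg \<and> \<beta> \<in> {..<N} \<times> Collect nonneg \<and> mless e \<alpha> \<beta>}"
    by blast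
  then have f: "f i \<in> {..<N} \<times> Collect nonneg" "mless e (f (Suc i)) (f i)" for i
    by (auto dest!: spec[of _ i])
  have chain: "mless e (f n) (f m)" if "m < n" for m n
    using that by (induction n) (auto simp: less_Suc_eq intro: f(2) mless_trans[OF assms f(2)])
  obtain m n where "m < n" "fst (f m) = fst (f n)" "nonneg (snd (f n) - snd (f m))"
  proof -
    have "\<exists>m n. m < n \<and> fst (f m) = fst (f n) \<and> nonneg (snd (f n) - snd (f m))"
      by (rule dickson[of f N]) (use f(1) in \<open>auto simp: mem_Times_iff\<close>)
    then show thesis using that by blast
  qed
  then show False using chain mless_not_ge by blast
qed

locale fg_graded_mod =
  fixes sc :: "'k::field \<Rightarrow> 'v::ab_group_add \<Rightarrow> 'v"
    and M :: "int ^ 'n::finite \<Rightarrow> 'v set"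
    and mu :: "int ^ 'n \<Rightarrow> int ^ 'n \<Rightarrow> 'v \<Rightarrow> 'v"
  assumes fg: "fg_graded_module sc M mu"
begin

sublocale graded_mod sc M mu
  using fg by unfold_locales (simp add: fg_graded_module_def)

definition single :: "int ^ 'n \<Rightarrow> 'v \<Rightarrow> int ^ 'n \<Rightarrow> 'v" where
  "single a v = (\<lambda>c. if c = a then v else 0)"

lemma single_X: "v \<in> M a \<Longrightarrow> single a v \<in> X"
  by (rule X_I[of "{a}"]) (auto simp: single_def M_0)

lemma mon_single: "nonneg b \<Longrightarrow> mon b (single a v) = single (a + b) (mu a b v)"
  by (auto simp: mon_def single_def fun_eq_iff mu_0 algebra_simps)

lemma single_span:
  assumes "v \<in> vs.span S" shows "single a v \<in> fs.span (single a ` S)"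
  using assms
proof (induction rule: vs.span_induct_alt)
  case base
  have "single a 0 = 0" by (auto simp: single_def)
  then show ?case by (metis fs.span_zero)
next
  case (step t w y)
  have "single a (sc t w + y) = psc t (single a w) + single a y"
    by (auto simp: single_def psc_def)
  then show ?case
    using fs.span_add[OF fs.span_scale[OF fs.span_base[OF imageI[OF step(1)]]] step(2)] by metis
qed

lemma X_decompose:
  assumes "u \<in> X" shows "u = (\<Sum>a\<in>{a. u a \<noteq> 0}. single a (u a))"
proof
  fix c
  have "(\<Sum>a\<in>{a. u a \<noteq> 0}. single a (u a)) c = (\<Sum>a\<in>{a. u a \<noteq> 0}. if c = a then u a else 0)"
    by (simp add: sum_fun_apply single_def)
  then show "u c = (\<Sum>a\<in>{a. u a \<noteq> 0}. single a (u a)) c"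
    using X_finite[OF assms] by simp
qed

text \<open>Order the multiples \<open>x\<^sup>b g\<close> of the generators lexicographically and replace each \<open>us N\<close>, modulo its
  predecessors, by \<open>w N\<close> with least leading monomial; Dickson's lemma contradicts minimality.\<close>
lemma noetherian_X:
  assumes us: "\<And>n::nat. us n \<in> X"
  shows "\<exists>N c. (\<forall>s<N. poly_op NN (c s)) \<and> us N = (\<Sum>s<N. c s (us s))"
proof (rule ccontr)
  assume contra: "\<not> ?thesis"
  obtain G where G: "finite G" "\<forall>(a, m)\<in>G. m \<in> M a"
    "\<And>c. M c \<subseteq> vs.span {mu a (c - a) m | a m. (a, m) \<in> G \<and> nonneg (c - a)}"
    using fg unfolding fg_graded_module_def by blast
  obtain r :: nat and gg where gg: "G = gg ` {..<r}"
    using G(1) unfolding finite_conv_nat_seg_image lessThan_def by metis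
  obtain e :: "'n \<Rightarrow> nat" where e: "inj e"
    using finite_imp_inj_to_nat_seg[of "UNIV :: 'n set"] by auto
  define B :: "(nat \<times> (int ^ 'n)) set" where "B = {..<r} \<times> NN"
  define eb where "eb \<alpha> = single (fst (gg (fst \<alpha>)) + snd \<alpha>) (mu (fst (gg (fst \<alpha>))) (snd \<alpha>) (snd (gg (fst \<alpha>))))" for \<alpha>
  have ggM: "snd (gg g) \<in> M (fst (gg g))" if "g < r" for g
    using G(2) gg that by force
  have ebX: "eb \<alpha> \<in> X" if "\<alpha> \<in> B" for \<alpha>
    using that ggM by (auto simp: eb_def B_def intro!: single_X mu_in)
  have eb_mon: "mon b (eb (g, a)) = eb (g, a + b)" if "(g, a) \<in> B" "nonneg b" for g a b
    using that ggM by (auto simp: eb_def B_def mon_single mu_mu add.assoc)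
  \<comment> \<open>The elements \<open>eb \<alpha>\<close> span but may be linearly dependent, so
    leading terms are not unique. \<open>Le \<alpha>\<close> and \<open>L \<alpha>\<close> say
    instead that some representation has all its terms up to, or strictly below,
    \<open>\<alpha>\<close>.\<close>
  define L where "L \<alpha> = fs.span (eb ` {\<beta>\<in>B. mless e \<beta> \<alpha>})" for \<alpha>
  define Le where "Le \<alpha> = fs.span (eb ` {\<beta>\<in>B. mless e \<beta> \<alpha> \<or> \<beta> = \<alpha>})" for \<alpha>
  have LX: "L \<alpha> \<subseteq> X" for \<alpha>
    unfolding L_def by (rule fs.span_minimal[OF _ subspace_X]) (use ebX in auto)
  have Le_mono: "Le \<alpha> \<subseteq> Le \<beta>" if "mless e \<alpha> \<beta>" for \<alpha> \<beta>
    unfolding Le_def by (rule fs.span_mono) (use that mless_trans[OF e] in blast)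
  have lead: "\<exists>\<alpha>\<in>S. u \<in> Le \<alpha>" if S: "S \<subseteq> B" and u: "u \<in> fs.span (eb ` S)" and u0: "u \<noteq> 0" for S u
  proof -
    let ?P = "{u. u = 0 \<or> (\<exists>\<alpha>\<in>S. u \<in> Le \<alpha>)}"
    have "fs.subspace ?P"
    proof (rule fs.subspaceI)
      show "0 \<in> ?P" by simp
      show "psc t u \<in> ?P" if "u \<in> ?P" for t u
        using that by (auto simp: Le_def intro: fs.span_scale)
      show "u + v \<in> ?P" if uv: "u \<in> ?P" "v \<in> ?P" for u v
      proof (cases "u = 0 \<or> v = 0")
        case True
        then show ?thesis using uv by auto
      next
        case False
        then obtain \<alpha> \<beta> where ab: "\<alpha> \<in> S" "\<beta> \<in> S" "u \<in> Le \<alpha>" "v \<in> Le \<beta>" using uv by auto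
        then obtain \<gamma> where "\<gamma> \<in> S" "u \<in> Le \<gamma>" "v \<in> Le \<gamma>"
          using mless_total[OF e, of \<alpha> \<beta>] Le_mono by blast
        then show ?thesis by (auto simp: Le_def intro: fs.span_add)
      qed
    qed
    moreover have "eb ` S \<subseteq> ?P" using S by (auto simp: Le_def intro!: fs.span_base)
    ultimately have "u \<in> ?P" using fs.span_minimal u by blast
    then show ?thesis using u0 by blast
  qed
  have Le_split: "\<exists>c. u - psc c (eb \<alpha>) \<in> L \<alpha>" if "\<alpha> \<in> B" "u \<in> Le \<alpha>" for \<alpha> u
  proof -
    have "{\<beta>\<in>B. mless e \<beta> \<alpha> \<or> \<beta> = \<alpha>} = insert \<alpha> {\<beta>\<in>B. mless e \<beta> \<alpha>}" using that(1) by auto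
    then have "u \<in> fs.span (insert (eb \<alpha>) (eb ` {\<beta>\<in>B. mless e \<beta> \<alpha>}))"
      using that(2) by (simp add: Le_def)
    then show ?thesis by (simp add: fs.span_breakdown_eq L_def)
  qed
  have L_mon: "mon b u \<in> L (g, a + b)" if b: "nonneg b" and u: "u \<in> L (g, a)" for b g a u
  proof -
    let ?P = "{u \<in> X. mon b u \<in> L (g, a + b)}"
    have "fs.subspace ?P"
      unfolding L_def
      by (rule fs.subspaceI)
        (auto simp: X_0 X_add X_psc mon_zero[OF b] mon_add[OF b] mon_psc[OF b]
          intro: fs.span_zero fs.span_add fs.span_scale)
    moreover have "eb ` {\<beta>\<in>B. mless e \<beta> (g, a)} \<subseteq> ?P"
    proof clarify
      fix h c assume hc: "(h, c) \<in> B" "mless e (h, c) (g, a)"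
      have "(h, c + b) \<in> {\<beta> \<in> B. mless e \<beta> (g, a + b)}"
        using hc(1) b mless_shift[OF hc(2)] by (auto simp: B_def nonneg_add)
      then show "eb (h, c) \<in> X \<and> mon b (eb (h, c)) \<in> L (g, a + b)"
        unfolding L_def eb_mon[OF hc(1) b] using ebX[OF hc(1)] by (blast intro: fs.span_base)
    qed
    ultimately have "L (g, a) \<subseteq> ?P"
      unfolding L_def[of "(g, a)"] by (intro fs.span_minimal)
    then show ?thesis using u by blast
  qed
  have XB: "X \<subseteq> fs.span (eb ` B)"
  proof
    fix u assume u: "u \<in> X"
    have "single c (u c) \<in> fs.span (eb ` B)" for c
    proof -
      have "u c \<in> vs.span {mu a (c - a) m | a m. (a, m) \<in> G \<and> nonneg (c - a)}"
        using G(3) X_comp[OF u] by blast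
      then have "single c (u c) \<in> fs.span (single c ` {mu a (c - a) m | a m. (a, m) \<in> G \<and> nonneg (c - a)})"
        by (rule single_span)
      moreover have "single c ` {mu a (c - a) m | a m. (a, m) \<in> G \<and> nonneg (c - a)} \<subseteq> eb ` B"
      proof clarify
        fix a m assume "(a, m) \<in> G" "nonneg (c - a)"
        then obtain g where "g < r" "gg g = (a, m)" using gg by (metis imageE lessThan_iff)
        then show "single c (mu a (c - a) m) \<in> eb ` B"
          using \<open>nonneg (c - a)\<close> by (intro image_eqI[of _ _ "(g, c - a)"]) (auto simp: eb_def B_def)
      qed
      ultimately show ?thesis using fs.span_mono by blast
    qed
    then show "u \<in> fs.span (eb ` B)" by (subst X_decompose[OF u]) (rule fs.span_sum)
  qed
  define U where "U N = {w. \<exists>c. (\<forall>s<N. poly_op NN (c s)) \<and> w = (\<Sum>s<N. c s (us s))}" for N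
  have us_U: "us N \<notin> U N" for N using contra by (auto simp: U_def)
  have U_add: "v + w \<in> U N" if vw: "v \<in> U N" "w \<in> U N" for v w N
  proof -
    obtain c d where "\<forall>s<N. poly_op NN (c s)" "v = (\<Sum>s<N. c s (us s))"
      "\<forall>s<N. poly_op NN (d s)" "w = (\<Sum>s<N. d s (us s))"
      using vw by (auto simp: U_def)
    then show ?thesis unfolding U_def
      by (intro CollectI exI[of _ "\<lambda>s u. c s u + d s u"]) (auto simp: poly_op_plus sum.distrib)
  qed
  have U_0: "0 \<in> U N" for N
    unfolding U_def by (intro CollectI exI[of _ "\<lambda>s u. 0"]) (auto simp: poly_op_zero)
  have U_psc: "psc t w \<in> U N" if w: "w \<in> U N" for t w N
  proof -
    obtain c where "\<forall>s<N. poly_op NN (c s)" "w = (\<Sum>s<N. c s (us s))"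
      using w by (auto simp: U_def)
    then show ?thesis unfolding U_def
      by (intro CollectI exI[of _ "\<lambda>s u. psc t (c s u)"]) (auto simp: poly_op_psc fs.scale_sum_right)
  qed
  have U_mon: "mon b w \<in> U N" if w: "w \<in> U N" and b: "nonneg b" for b w N
  proof -
    obtain c where c: "\<forall>s<N. poly_op NN (c s)" "w = (\<Sum>s<N. c s (us s))"
      using w by (auto simp: U_def)
    have "mon b w = (\<Sum>s<N. mon b (c s (us s)))"
      unfolding c(2) using c(1) us by (intro mon_sum[OF b]) (auto intro: poly_op_in)
    moreover have "\<forall>s<N. poly_op NN (\<lambda>u. mon b (c s u))"
      using c(1) b by (auto intro!: poly_op_mon_comp nonneg_add)
    ultimately show ?thesis unfolding U_def
      by (intro CollectI exI[of _ "\<lambda>s u. mon b (c s u)"]) auto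
  qed
  have U_diff: "v - w \<in> U N" if "v \<in> U N" "w \<in> U N" for v w N
    using U_add[OF that(1) U_psc[OF that(2), of "-1"]] by simp
  have U_mono: "U m \<subseteq> U n" if "m \<le> n" for m n
  proof
    fix w assume "w \<in> U m"
    then obtain c where c: "\<forall>s<m. poly_op NN (c s)" "w = (\<Sum>s<m. c s (us s))" by (auto simp: U_def)
    have "(\<Sum>s<n. (if s < m then c s else (\<lambda>u. 0)) (us s)) = (\<Sum>s<m. (if s < m then c s else (\<lambda>u. 0)) (us s))"
      by (rule sum.mono_neutral_right) (use that in auto)
    then show "w \<in> U n" unfolding U_def
      using c by (intro CollectI exI[of _ "\<lambda>s. if s < m then c s else (\<lambda>u. 0)"]) (auto simp: poly_op_zero)
  qed
  have us_Suc: "us N \<in> U (Suc N)" for N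
  proof -
    have "poly_op NN (mon 0)" by (rule poly_op_mon) simp
    moreover have "us N = (\<Sum>s<Suc N. (if s = N then mon 0 else (\<lambda>u. 0)) (us s))"
      using mon_id[OF us] by simp
    ultimately show ?thesis unfolding U_def
      by (intro CollectI exI[of _ "\<lambda>s. if s = N then mon 0 else (\<lambda>u. 0)"]) (auto simp: poly_op_zero)
  qed
  define P where "P N \<alpha> \<longleftrightarrow> \<alpha> \<in> B \<and> (\<exists>w. w - us N \<in> U N \<and> w \<in> Le \<alpha>)" for N \<alpha>
  have nz: "w \<noteq> 0" if "w - us N \<in> U N" for w N
    using that us_U[of N] U_diff[OF U_0 that] by auto
  have "\<exists>\<alpha>. P N \<alpha> \<and> (\<forall>\<beta>. mless e \<beta> \<alpha> \<longrightarrow> \<not> P N \<beta>)" for N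
  proof -
    have "us N - us N \<in> U N" using U_0 by simp
    then have "\<exists>\<alpha>\<in>B. us N \<in> Le \<alpha>" using lead[OF order.refl] XB us nz by blast
    then obtain \<alpha>0 where "\<alpha>0 \<in> Collect (P N)"
      using \<open>us N - us N \<in> U N\<close> unfolding P_def by blast
    then obtain \<alpha> where "\<alpha> \<in> Collect (P N)"
      "\<And>\<beta>. (\<beta>, \<alpha>) \<in> {(\<alpha>, \<beta>). \<alpha> \<in> {..<r} \<times> NN \<and> \<beta> \<in> {..<r} \<times> NN \<and> mless e \<alpha> \<beta>} \<Longrightarrow> \<beta> \<notin> Collect (P N)"
      by (rule wfE_min[OF mless_wf[OF e, of r]]) blast
    then show ?thesis by (intro exI[of _ \<alpha>]) (auto simp: P_def B_def)
  qed
  then obtain al where al: "\<And>N. P N (al N)" "\<And>N \<beta>. mless e \<beta> (al N) \<Longrightarrow> \<not> P N \<beta>" by metis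
  then obtain w where w: "\<And>N. w N - us N \<in> U N" "\<And>N. w N \<in> Le (al N)" and alB: "\<And>N. al N \<in> B"
    unfolding P_def by metis
  have minL: "v \<notin> L (al N)" if v: "v - us N \<in> U N" for v N
  proof
    assume "v \<in> L (al N)"
    then obtain \<beta> where "\<beta> \<in> B" "mless e \<beta> (al N)" "v \<in> Le \<beta>"
      using lead[of "{\<beta> \<in> B. mless e \<beta> (al N)}" v] nz[OF v] by (auto simp: L_def)
    then show False using al(2) v unfolding P_def by blast
  qed
  obtain m n where mn: "m < n" "fst (al m) = fst (al n)" "nonneg (snd (al n) - snd (al m))"
  proof -
    have "\<exists>m n. m < n \<and> fst (al m) = fst (al n) \<and> nonneg (snd (al n) - snd (al m))"
      by (rule dickson[of al r]) (use alB in \<open>auto simp: B_def mem_Times_iff\<close>)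
    then show thesis using that by blast
  qed
  define b where "b = snd (al n) - snd (al m)"
  have b: "nonneg b" using mn by (simp add: b_def)
  obtain g a where am: "al m = (g, a)" by (cases "al m")
  have an: "al n = (g, a + b)" using mn(2) am by (simp add: b_def prod_eq_iff)
  obtain c where c: "w m - psc c (eb (al m)) \<in> L (al m)" using Le_split[OF alB w(2)] by blast
  obtain d where d: "w n - psc d (eb (al n)) \<in> L (al n)" using Le_split[OF alB w(2)] by blast
  have c0: "c \<noteq> 0"
  proof
    assume "c = 0"
    then have "w m \<in> L (al m)" using c by simp
    then show False using minL w(1) by blast
  qed
  define l where "l = w m - psc c (eb (al m))"
  have lX: "l \<in> X" unfolding l_def using c LX by blast
  have "w m = psc c (eb (al m)) + l" by (simp add: l_def)
  then have "mon b (w m) = psc c (eb (al n)) + mon b l"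
    using mon_add[OF b X_psc[OF ebX[OF alB[of m]]] lX, of c] mon_psc[OF b ebX[OF alB[of m]], of c]
      eb_mon[of g a b] alB[of m] b am an by simp
  then have "psc (d / c) (mon b (w m)) = psc d (eb (al n)) + psc (d / c) (mon b l)"
    using c0 by (simp add: fs.scale_right_distrib)
  moreover have "mon b l \<in> L (al n)" using L_mon[OF b, of l g a] c am an by (simp add: l_def)
  \<comment> \<open>By minimality of \<open>al m\<close> the coefficient \<open>c\<close> is
    nonzero, so a multiple of x^b \<open>w m\<close> cancels the leading term of \<open>w n\<close>.
    As \<open>w m\<close> belongs to \<open>U n\<close>, the difference still represents
    \<open>us n\<close>, but below \<open>al n\<close>.\<close>
  ultimately have "w n - psc (d / c) (mon b (w m)) \<in> L (al n)"
    using d fs.span_diff[OF d[unfolded L_def] fs.span_scale, of "mon b l" "d / c"]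
    by (simp add: L_def algebra_simps)
  moreover have "w n - psc (d / c) (mon b (w m)) - us n \<in> U n"
  proof -
    have "w m - us m \<in> U (Suc m)" using w(1) U_mono[of m "Suc m"] by auto
    then have "w m \<in> U (Suc m)" using U_add[OF _ us_Suc[of m], of "w m - us m"] by simp
    then have "w m \<in> U n" using U_mono[of "Suc m" n] mn(1) by auto
    then have "(w n - us n) - psc (d / c) (mon b (w m)) \<in> U n"
      by (intro U_diff U_psc U_mon w(1) b)
    then show ?thesis by (simp add: algebra_simps)
  qed
  ultimately show False using minL by blast
qed

end

section \<open>Regular sequences avoiding a variable\<close>

text \<open>Leaving out the exponent 0 encodes a vanishing constant term, so that membership in the
  maximal ideal becomes a condition on the support.\<close>

definition exps :: "'n set \<Rightarrow> (int ^ 'n::finite) set" where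
  "exps A = {b. nonneg b \<and> b \<noteq> 0 \<and> (\<forall>k. k \<notin> A \<longrightarrow> b $ k = 0)}"

lemma exps_nonneg: "exps A \<subseteq> Collect nonneg"
  by (auto simp: exps_def)

lemma exps_add: "a \<in> exps A \<Longrightarrow> b \<in> exps A \<Longrightarrow> a + b \<in> exps A"
proof -
  assume ab: "a \<in> exps A" "b \<in> exps A"
  then have nn: "\<And>k. 0 \<le> a $ k" "\<And>k. 0 \<le> b $ k" by (auto simp: exps_def nonneg_def)
  have "a + b \<noteq> 0"
  proof
    assume "a + b = 0"
    then have "a $ k + b $ k = 0" for k by (metis vector_add_component zero_index)
    then have "a $ k = 0" for k using nn[of k] by (smt (verit))
    then show False using ab by (auto simp: exps_def vec_eq_iff)
  qed
  then show ?thesis using ab by (auto simp: exps_def nonneg_add)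
qed

lemma axis_exps: "k \<in> A \<Longrightarrow> axis k 1 \<in> exps A"
  by (auto simp: exps_def axis_def vec_eq_iff nonneg_def)

lemma polynomial_exps: "polynomial f \<and> f 0 = 0 \<longleftrightarrow> finite {b. f b \<noteq> 0} \<and> {b. f b \<noteq> 0} \<subseteq> exps UNIV"
  by (auto simp: polynomial_def exps_def)

context graded_mod
begin

text \<open>For a nonzero finitely generated module this certifies depth at least
  \<open>length gs + 1\<close>; the socle clause stands in for the missing element. Polynomials are
  listed rather than operators, so that the same list can be read on M and on its pull-back.\<close>

definition almost_regular :: "'n \<Rightarrow> (int ^ 'n \<Rightarrow> 'k) list \<Rightarrow> bool" where
  "almost_regular i gs \<longleftrightarrow>
     (\<forall>g\<in>set gs. finite {b. g b \<noteq> 0} \<and> {b. g b \<noteq> 0} \<subseteq> exps (- {i})) \<and>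
     (\<forall>l<length gs. \<forall>u\<in>X. act (gs ! l) u \<in> ideal_times sc M mu (take l gs)
        \<longrightarrow> u \<in> ideal_times sc M mu (take l gs)) \<and>
     (\<forall>u\<in>X. (\<forall>k. mon (axis k 1) u \<in> ideal_times sc M mu gs) \<longrightarrow> u \<in> ideal_times sc M mu gs)"

end

context fg_graded_mod
begin

lemma noetherian_action_X: "noetherian_action X (Collect (poly_op NN)) (\<lambda>k. mon (axis k 1))"
proof unfold_locales
  show "(\<lambda>u. u) \<in> Collect (poly_op NN)"
    using poly_op_cong[OF poly_op_mon[of 0 NN], of "\<lambda>u. u"] by (simp add: mon_id)
  show "(\<lambda>u. - r u) \<in> Collect (poly_op NN)" if "r \<in> Collect (poly_op NN)" for r
    using poly_op_psc[of NN r "-1"] that by simp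
  show "(\<lambda>u. r (s u)) \<in> Collect (poly_op NN)"
    if "r \<in> Collect (poly_op NN)" "s \<in> Collect (poly_op NN)" for r s
    using poly_op_comp[of NN r NN s NN] that by (auto simp: nonneg_add)
  show "\<exists>N c. (\<forall>s<N. c s \<in> Collect (poly_op NN)) \<and> us N = (\<Sum>s<N. c s (us s))"
    if "\<And>n::nat. us n \<in> X" for us
    using noetherian_X[OF that] by auto
qed (auto intro: X_0 X_diff poly_op_in poly_op_add poly_op_comm poly_op_plus poly_op_mon)

sublocale na: noetherian_action X "Collect (poly_op NN)" "\<lambda>k. mon (axis k 1)"
  by (rule noetherian_action_X)

lemma ideal_times_snoc:
  "ideal_times sc M mu (fs @ [f]) = na.ext (ideal_times sc M mu fs) (act f)"
proof (intro set_eqI iffI)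
  fix a assume "a \<in> ideal_times sc M mu (fs @ [f])"
  then obtain w where w: "\<forall>l<Suc (length fs). module_elem M (w l)"
    and a: "a = (\<lambda>c. \<Sum>l<Suc (length fs). act ((fs @ [f]) ! l) (w l) c)"
    by (auto simp: ideal_times_def)
  have "a = (\<lambda>c. \<Sum>l<length fs. act (fs ! l) (w l) c) + act f (w (length fs))"
    unfolding a by (auto simp: fun_eq_iff nth_append intro!: sum.cong)
  moreover have "(\<lambda>c. \<Sum>l<length fs. act (fs ! l) (w l) c) \<in> ideal_times sc M mu fs"
    unfolding ideal_times_def using w by (intro CollectI exI[of _ w]) auto
  moreover have "w (length fs) \<in> X" using w by (simp add: X_def)
  ultimately show "a \<in> na.ext (ideal_times sc M mu fs) (act f)"
    unfolding na.ext_def by blast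
next
  fix a assume "a \<in> na.ext (ideal_times sc M mu fs) (act f)"
  then obtain k u where a: "a = k + act f u" and k: "k \<in> ideal_times sc M mu fs" and u: "u \<in> X"
    by (auto simp: na.ext_def)
  obtain w where w: "\<forall>l<length fs. module_elem M (w l)"
    "k = (\<lambda>c. \<Sum>l<length fs. act (fs ! l) (w l) c)"
    using k by (auto simp: ideal_times_def)
  define w' where "w' = w(length fs := u)"
  have "a = (\<lambda>c. \<Sum>l<length (fs @ [f]). act ((fs @ [f]) ! l) (w' l) c)"
    unfolding a w(2) by (auto simp: fun_eq_iff nth_append w'_def intro!: sum.cong)
  moreover have "\<forall>l<length (fs @ [f]). module_elem M (w' l)"
    using w(1) u by (auto simp: w'_def X_def less_Suc_eq)
  ultimately show "a \<in> ideal_times sc M mu (fs @ [f])" unfolding ideal_times_def by blast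
qed

lemma ideal_times_foldl: "ideal_times sc M mu fs = foldl na.ext {0} (map act fs)"
proof (induction fs rule: rev_induct)
  case Nil
  show ?case by (auto simp: ideal_times_def fun_eq_iff)
next
  case (snoc f fs)
  then show ?case by (simp add: ideal_times_snoc)
qed

lemma submod_ideal_times:
  assumes "\<And>f. f \<in> set fs \<Longrightarrow> finite {b. f b \<noteq> 0} \<and> {b. f b \<noteq> 0} \<subseteq> NN"
  shows "na.submod (ideal_times sc M mu fs)"
  unfolding ideal_times_foldl using assms
  by (intro na.submod_foldl_ext na.submod_zero) (auto intro: poly_op_act)

lemma regs_act_iff:
  "na.regs {0} (map act fs) \<longleftrightarrow> (\<forall>l<length fs. \<forall>u\<in>X. act (fs ! l) u \<in> ideal_times sc M mu (take l fs)
     \<longrightarrow> u \<in> ideal_times sc M mu (take l fs))"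
  unfolding na.regs_iff na.reg_def ideal_times_foldl by (simp add: take_map)

section \<open>Degree bounds and the graded Nakayama lemma\<close>

lemma bounded_below: "\<exists>B. \<forall>c k. M c \<noteq> {0} \<longrightarrow> B \<le> c $ k"
proof -
  obtain G where G: "finite G" "\<forall>(a, m)\<in>G. m \<in> M a"
    "\<And>c. M c \<subseteq> vs.span {mu a (c - a) m | a m. (a, m) \<in> G \<and> nonneg (c - a)}"
    using fg unfolding fg_graded_module_def by blast
  let ?S = "(\<lambda>(g, k). fst g $ k) ` (G \<times> UNIV)"
  have fin: "finite ?S" using G(1) by simp
  \<comment> \<open>The inserted 0 keeps \<open>Min\<close> meaningful when there are no
    generators.\<close>
  have "Min (insert 0 ?S) \<le> c $ k" if c: "M c \<noteq> {0}" for c k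
  proof -
    have "{mu a (c - a) m | a m. (a, m) \<in> G \<and> nonneg (c - a)} \<noteq> {}"
    proof
      assume "{mu a (c - a) m | a m. (a, m) \<in> G \<and> nonneg (c - a)} = {}"
      then have "M c \<subseteq> {0}" using G(3)[of c] by (metis vs.span_empty)
      then show False using c M_0 by blast
    qed
    then obtain a m where am: "(a, m) \<in> G" "nonneg (c - a)" by blast
    have "a $ k \<in> ?S" using am by force
    then have "Min (insert 0 ?S) \<le> a $ k" using fin by simp
    also have "\<dots> \<le> c $ k" using am(2) by (simp add: nonneg_def)
    finally show ?thesis .
  qed
  then show ?thesis by blast
qed

text \<open>In a nonzero component of least total degree the submodule generated by
  \<open>fs\<close> vanishes: a polynomial without constant term, even an inhomogeneous one, reaches
  degree \<open>c0\<close> only from strictly lower degrees, where M is zero.\<close>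

lemma graded_nakayama:
  assumes c: "M c \<noteq> {0}" and fs: "\<And>f. f \<in> set fs \<Longrightarrow> polynomial f \<and> f 0 = 0"
  shows "\<exists>u. module_elem M u \<and> u \<notin> ideal_times sc M mu fs"
proof -
  obtain B where B: "\<And>c k. M c \<noteq> {0} \<Longrightarrow> B \<le> c $ k" using bounded_below by blast
  define ht where "ht c = nat (\<Sum>k\<in>UNIV. c $ k - B)" for c :: "int ^ 'n"
  obtain c0 where c0: "M c0 \<noteq> {0}" "\<And>c. M c \<noteq> {0} \<Longrightarrow> ht c0 \<le> ht c"
    using ex_has_least_nat[of "\<lambda>c. M c \<noteq> {0}" c ht] c by blast
  have zero: "M (c0 - b) = {0}" if b: "b \<in> exps UNIV" for b
  proof (rule ccontr)
    assume nz: "M (c0 - b) \<noteq> {0}"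
    have "\<exists>k. 0 < b $ k" using b by (force simp: exps_def nonneg_def vec_eq_iff order.order_iff_strict)
    then have "(\<Sum>k\<in>UNIV. (c0 - b) $ k - B) < (\<Sum>k\<in>UNIV. c0 $ k - B)"
      using b by (intro sum_strict_mono_ex1) (auto simp: exps_def nonneg_def)
    moreover have "0 \<le> (\<Sum>k\<in>UNIV. (c0 - b) $ k - B)"
      using B[OF nz] by (intro sum_nonneg) simp
    ultimately show False using c0(2)[OF nz] by (simp add: ht_def)
  qed
  obtain v where v: "v \<in> M c0" "v \<noteq> 0" using c0(1) M_0 by blast
  have vanish: "act f w c0 = 0" if f: "polynomial f \<and> f 0 = 0" and w: "module_elem M w" for f w
  proof -
    have "sc (f b) (mu (c0 - b) b (w (c0 - b))) = 0" if fb: "f b \<noteq> 0" for b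
    proof -
      have b: "b \<in> exps UNIV" using f fb polynomial_exps by blast
      have "w (c0 - b) = 0" using zero[OF b] w by (auto simp: module_elem_def)
      then show ?thesis using b by (simp add: exps_def mu_0)
    qed
    then show ?thesis by (simp add: pact_def)
  qed
  have "single c0 v \<notin> ideal_times sc M mu fs"
  proof
    assume "single c0 v \<in> ideal_times sc M mu fs"
    then obtain w where w: "\<forall>l<length fs. module_elem M (w l)"
      and s: "single c0 v = (\<lambda>c. \<Sum>l<length fs. act (fs ! l) (w l) c)"
      by (auto simp: ideal_times_def)
    have "single c0 v c0 = 0" unfolding s using w fs vanish by (intro sum.neutral) auto
    then show False using v by (simp add: single_def)
  qed
  then show ?thesis using single_X[OF v(1)] by (auto simp: X_def)
qed

text \<open>By \<open>graded_nakayama\<close> the properness clause does not depend on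
  \<open>fs\<close>; it only says that M is nonzero.\<close>

lemma regular_sequence_iff:
  "regular_sequence sc M mu fs \<longleftrightarrow>
     (\<forall>f\<in>set fs. polynomial f \<and> f 0 = 0) \<and> na.regs {0} (map act fs) \<and> (\<exists>c. M c \<noteq> {0})"
proof -
  have "\<exists>c. M c \<noteq> {0}" if u: "module_elem M u" "u \<notin> ideal_times sc M mu fs"
    and fs: "\<forall>f\<in>set fs. polynomial f \<and> f 0 = 0" for u
  proof (rule ccontr)
    assume "\<nexists>c. M c \<noteq> {0}"
    then have "u = 0" using u(1) by (auto simp: module_elem_def fun_eq_iff)
    moreover have "na.submod (ideal_times sc M mu fs)"
      using fs by (intro submod_ideal_times) (auto simp: polynomial_def)
    ultimately show False using u(2) na.submodD(2) by blast
  qed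
  moreover have "\<exists>u. module_elem M u \<and> u \<notin> ideal_times sc M mu fs"
    if "M c \<noteq> {0}" "\<forall>f\<in>set fs. polynomial f \<and> f 0 = 0" for c
    using graded_nakayama[OF that(1), of fs] that(2) by blast
  ultimately have "(\<forall>f\<in>set fs. polynomial f \<and> f 0 = 0) \<Longrightarrow>
      (\<exists>u. module_elem M u \<and> u \<notin> ideal_times sc M mu fs) \<longleftrightarrow> (\<exists>c. M c \<noteq> {0})"
    by metis
  moreover have "regular_sequence sc M mu fs \<longleftrightarrow> (\<forall>f\<in>set fs. polynomial f \<and> f 0 = 0) \<and>
      na.regs {0} (map act fs) \<and> (\<exists>u. module_elem M u \<and> u \<notin> ideal_times sc M mu fs)"
    unfolding regular_sequence_def regs_act_iff by (simp add: X_def all_set_conv_all_nth) metis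
  ultimately show ?thesis by argo
qed

section \<open>Regular versus almost regular sequences\<close>

lemma gen_ops_poly_op:
  "r \<in> gen_ops ((\<lambda>k. mon (axis k 1)) ` A) \<Longrightarrow> poly_op (exps A) r"
proof (induction rule: gen_ops.induct)
  case gen_zero
  show ?case by (rule poly_op_zero)
next
  case (gen_base z)
  then show ?case by (auto intro: poly_op_mon axis_exps)
next
  case (gen_plus f g)
  then show ?case using poly_op_plus by blast
next
  case (gen_comp f g)
  then show ?case using poly_op_comp[OF _ _ exps_nonneg exps_nonneg exps_add] by blast
qed

lemma J_cong: "r \<in> na.J \<Longrightarrow> (\<And>u. u \<in> X \<Longrightarrow> r' u = r u) \<Longrightarrow> r' \<in> na.J"
  unfolding na.J_def by (auto intro: poly_op_cong)

text \<open>Every monomial with nonzero exponent factors through some variable.\<close>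

lemma act_in_J:
  assumes f: "polynomial f" "f 0 = 0" shows "act f \<in> na.J"
proof -
  have fin: "finite {b. f b \<noteq> 0}" and exps: "{b. f b \<noteq> 0} \<subseteq> exps UNIV"
    using f polynomial_exps by blast+
  have "(\<lambda>u. psc (f b) (mon b u)) \<in> na.J" if b: "b \<in> exps UNIV" for b
  proof -
    obtain k where k: "0 < b $ k" using b by (force simp: exps_def nonneg_def vec_eq_iff order.order_iff_strict)
    then have nn: "nonneg (b - axis k 1)" using b by (auto simp: exps_def nonneg_def axis_def)
    have "poly_op NN (\<lambda>u. psc (f b) (mon (b - axis k 1) u))"
      using nn by (intro poly_op_psc poly_op_mon) auto
    then have "(\<lambda>u. psc (f b) (mon (b - axis k 1) (mon (axis k 1) u))) \<in> na.J"
      using na.comp_J[OF _ na.x_J] by blast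
    then show ?thesis by (rule J_cong) (simp add: mon_mon[OF nn])
  qed
  then have 1: "\<And>b. b \<in> {b. f b \<noteq> 0} \<Longrightarrow> (\<lambda>u. psc (f b) (mon b u)) \<in> na.J"
    using exps by blast
  have 2: "(\<lambda>u. \<Sum>b\<in>F. r b u) \<in> na.J" if "\<And>b. b \<in> F \<Longrightarrow> r b \<in> na.J" "finite F"
    for F :: "(int ^ 'n) set" and r
    using that(2,1)
  proof (induction F rule: finite_induct)
    case empty
    show ?case unfolding sum.empty by (rule na.zero_J)
  next
    case (insert b F)
    then show ?case unfolding sum.insert[OF insert(1,2)]
      by (intro na.plus_J) blast+
  qed
  have "(\<lambda>u. \<Sum>b\<in>{b. f b \<noteq> 0}. psc (f b) (mon b u)) \<in> na.J"
    using 2[of "{b. f b \<noteq> 0}" "\<lambda>b u. psc (f b) (mon b u)"] 1 fin by blast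
  then show ?thesis by (rule J_cong) (rule act_eq[OF fin order.refl])
qed

definition trunc :: "'n \<Rightarrow> int \<Rightarrow> (int ^ 'n \<Rightarrow> 'v) \<Rightarrow> int ^ 'n \<Rightarrow> 'v" where
  "trunc i t u = (\<lambda>c. if c $ i \<le> t then u c else 0)"

lemma regular_imp_almost_regular:
  assumes reg: "regular_sequence sc M mu fs" and len: "length fs = Suc d"
  shows "\<exists>gs. length gs = d \<and> almost_regular i gs"
proof -
  have fs: "\<forall>f\<in>set fs. polynomial f \<and> f 0 = 0" "na.regs {0} (map act fs)"
    using reg regular_sequence_iff by auto
  have D: "na.depth_ge (Suc d) {0}"
    unfolding na.depth_ge_def using fs len act_in_J by (intro exI[of _ "map act fs"]) auto
  have pow_vanish: "((mon (axis i 1)) ^^ N) v c = 0"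
    if "\<And>c k. M c \<noteq> {0} \<Longrightarrow> B \<le> c $ k" "v \<in> X" "c $ i < B + int N" for B N v c
    using that(2,3)
  proof (induction N arbitrary: c)
    case 0
    then show ?case using that(1)[of c i] X_comp[OF 0(1), of c] by fastforce
  next
    case (Suc N)
    have "(c - axis i 1) $ i < B + int N" using Suc.prems by simp
    then have "((mon (axis i 1)) ^^ N) v (c - axis i 1) = 0" using Suc by blast
    then show ?case by (simp add: mon_def[of _ "(_ ^^ _) _"] mu_0)
  qed
  have "\<exists>ys. length ys = d \<and> set ys \<subseteq> gen_ops ((\<lambda>k. mon (axis k 1)) ` (- {i})) \<and>
      na.regs {0} ys \<and> na.soc0 UNIV (foldl na.ext {0} ys)"
  proof (rule na.regular_avoiding_variable[of "range (trunc i)"])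
    show "t u \<in> X" if "t \<in> range (trunc i)" "u \<in> X" for t u
      using that by (intro X_I[of "{c. u c \<noteq> 0}"]) (auto simp: trunc_def X_comp M_0 X_finite)
    show "t (u + v) = t u + t v" if "t \<in> range (trunc i)" for t u v
      using that by (auto simp: trunc_def fun_eq_iff)
    show "t (mon (axis k 1) u) = mon (axis k 1) (t u)" if "t \<in> range (trunc i)" "k \<noteq> i" for t k u
      using that by (auto simp: trunc_def mon_def fun_eq_iff axis_def mu_0[OF nonneg_axis[unfolded axis_def]])
    show "\<exists>t\<in>range (trunc i). \<exists>N. t u = u \<and> (\<forall>v\<in>X. t ((mon (axis i 1) ^^ N) v) = 0)" if u: "u \<in> X" for u
    proof -
      obtain B where B: "\<And>c k. M c \<noteq> {0} \<Longrightarrow> B \<le> c $ k" using bounded_below by blast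
      \<comment> \<open>\<open>t\<close> bounds the i-degrees in the support of \<open>u\<close>,
        the inserted 0 serving the case u = 0. As \<open>B\<close> bounds the degrees of M from
        below, multiplication by x_i to the power t - B + 1 pushes everything above
        \<open>t\<close>.\<close>
      define t where "t = Max (insert 0 ((\<lambda>c. c $ i) ` {c. u c \<noteq> 0}))"
      have "c $ i \<le> t" if "u c \<noteq> 0" for c
        unfolding t_def using that X_finite[OF u] by (intro Max_ge) auto
      then have "trunc i t u = u" by (force simp: trunc_def fun_eq_iff)
      moreover have "trunc i t ((mon (axis i 1) ^^ nat (t - B + 1)) v) = 0" if "v \<in> X" for v
        using pow_vanish[OF B that] by (auto simp: trunc_def fun_eq_iff)
      ultimately show ?thesis by blast
    qed
    show "t u \<in> {0}" if "t \<in> range (trunc i)" "u \<in> {0}" for t u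
      using that by (auto simp: trunc_def fun_eq_iff)
  qed (use D na.submod_zero in auto)
  then obtain ys where ys: "length ys = d" "set ys \<subseteq> gen_ops ((\<lambda>k. mon (axis k 1)) ` (- {i}))"
    "na.regs {0} ys" "na.soc0 UNIV (foldl na.ext {0} ys)" by blast
  \<comment> \<open>Return from operators to polynomials: one is chosen per operator, and the
    submodules depend only on its action on \<open>X\<close>.\<close>
  have "\<forall>y\<in>set ys. \<exists>g. finite {b. g b \<noteq> 0} \<and> {b. g b \<noteq> 0} \<subseteq> exps (- {i}) \<and> (\<forall>u\<in>X. y u = act g u)"
    using ys(2) gen_ops_poly_op unfolding poly_op_def by blast
  then obtain p where p: "\<And>y. y \<in> set ys \<Longrightarrow> finite {b. p y b \<noteq> 0} \<and> {b. p y b \<noteq> 0} \<subseteq> exps (- {i}) \<and> (\<forall>u\<in>X. y u = act (p y) u)"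
    by metis
  have cong: "foldl na.ext K (map (act \<circ> p) zs) = foldl na.ext K zs" if "set zs \<subseteq> set ys" for K zs
    using that
  proof (induction zs arbitrary: K)
    case (Cons z zs)
    have "na.ext K (act (p z)) = na.ext K z"
      using p[of z] Cons.prems by (force simp: na.ext_def)
    then show ?case using Cons by simp
  qed simp
  have foldl_eq: "ideal_times sc M mu (map p zs) = foldl na.ext {0} zs" if "set zs \<subseteq> set ys" for zs
    using cong[OF that] by (simp add: ideal_times_foldl)
  have "almost_regular i (map p ys)"
    unfolding almost_regular_def
  proof (intro conjI)
    show "\<forall>g\<in>set (map p ys). finite {b. g b \<noteq> 0} \<and> {b. g b \<noteq> 0} \<subseteq> exps (- {i})"
      using p by auto
    show "\<forall>l<length (map p ys). \<forall>u\<in>X. act (map p ys ! l) u \<in> ideal_times sc M mu (take l (map p ys))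
        \<longrightarrow> u \<in> ideal_times sc M mu (take l (map p ys))"
      using ys(3) p unfolding na.regs_iff na.reg_def
      by (auto simp: take_map foldl_eq set_take_subset)
    show "\<forall>u\<in>X. (\<forall>k. mon (axis k 1) u \<in> ideal_times sc M mu (map p ys)) \<longrightarrow> u \<in> ideal_times sc M mu (map p ys)"
      using ys(4) by (simp add: foldl_eq na.soc0_def)
  qed
  then show ?thesis using ys(1) by (intro exI[of _ "map p ys"]) simp
qed

text \<open>The vanishing socle yields one more regular element, taken in all variables; this last
  one may involve x_i.\<close>

lemma almost_regular_imp_regular:
  assumes gs: "almost_regular i gs" and nz: "M c \<noteq> {0}"
  shows "\<exists>fs. length fs = Suc (length gs) \<and> regular_sequence sc M mu fs"
proof -
  have g: "\<forall>g\<in>set gs. finite {b. g b \<noteq> 0} \<and> {b. g b \<noteq> 0} \<subseteq> exps (- {i})"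
    using gs by (simp add: almost_regular_def)
  have sub: "exps (- {i}) \<subseteq> exps (UNIV :: 'n set)" by (auto simp: exps_def)
  have K: "na.submod (ideal_times sc M mu gs)"
    using g exps_nonneg by (intro submod_ideal_times) blast
  have "na.soc0 UNIV (ideal_times sc M mu gs)"
    using gs by (simp add: almost_regular_def na.soc0_def)
  then obtain h where h: "h \<in> gen_ops ((\<lambda>k. mon (axis k 1)) ` UNIV)" "na.reg h (ideal_times sc M mu gs)"
    using na.ex_regular[of "{ideal_times sc M mu gs}" UNIV] K by blast
  obtain f where f: "finite {b. f b \<noteq> 0}" "{b. f b \<noteq> 0} \<subseteq> exps UNIV" "\<forall>u\<in>X. h u = act f u"
    using gen_ops_poly_op[OF h(1)] unfolding poly_op_def by blast
  have "na.regs {0} (map act (gs @ [f]))"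
    unfolding regs_act_iff
  proof (intro allI impI ballI)
    fix l u assume l: "l < length (gs @ [f])" and u: "u \<in> X"
      and a: "act ((gs @ [f]) ! l) u \<in> ideal_times sc M mu (take l (gs @ [f]))"
    show "u \<in> ideal_times sc M mu (take l (gs @ [f]))"
    proof (cases "l = length gs")
      case True
      then show ?thesis using a u h(2) f(3) by (simp add: na.reg_def)
    next
      case False
      then show ?thesis using a u l gs by (simp add: almost_regular_def nth_append)
    qed
  qed
  moreover have "\<forall>f\<in>set (gs @ [f]). polynomial f \<and> f 0 = 0"
    unfolding polynomial_exps set_append using g f sub by (metis (no_types, lifting) Un_iff empty_iff empty_set list.simps(15) insert_iff order_trans)
  ultimately have "regular_sequence sc M mu (gs @ [f])"
    using nz regular_sequence_iff by blast
  then show ?thesis by (intro exI[of _ "gs @ [f]"]) simp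
qed

end

section \<open>Pull-back along a coordinate map\<close>

definition upd :: "'n \<Rightarrow> (int \<Rightarrow> int) \<Rightarrow> int ^ 'n::finite \<Rightarrow> int ^ 'n" where
  "upd i p a = (\<chi> k. if k = i then p (a $ k) else a $ k)"

lemma upd_component [simp]: "upd i p a $ k = (if k = i then p (a $ i) else a $ k)"
  by (simp add: upd_def)

text \<open>\<open>lam\<close> is the lower adjoint of \<open>p\<close>: the preimage under \<open>p\<close> of the ray starting at \<open>t\<close> is the ray
  starting at \<open>lam t\<close>, so pulling back along \<open>p\<close> preserves finite generation.\<close>
locale coord_pull = fg_graded_mod sc M mu
  for sc :: "'k::field \<Rightarrow> 'v::ab_group_add \<Rightarrow> 'v"
    and M :: "int ^ 'n::finite \<Rightarrow> 'v set"
    and mu :: "int ^ 'n \<Rightarrow> int ^ 'n \<Rightarrow> 'v \<Rightarrow> 'v" +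
  fixes i :: 'n and p lam :: "int \<Rightarrow> int"
  assumes galois: "t \<le> p s \<longleftrightarrow> lam t \<le> s"
begin

abbreviation "q \<equiv> upd i p"

lemma p_mono: "s \<le> t \<Longrightarrow> p s \<le> p t"
  using galois[of "p s" s] galois[of "p s" t] by simp

lemma nonneg_q: "nonneg b \<Longrightarrow> nonneg (q (a + b) - q a)"
  by (auto simp: nonneg_def p_mono)

lemma nonneg_q_diff: "nonneg (q c - a) \<longleftrightarrow> nonneg (c - upd i lam a)"
  by (auto simp: nonneg_def galois)

lemma graded_module_pull: "graded_module sc (pull_M q M) (pull_mu q mu)"
  unfolding graded_module_def pull_M_def pull_mu_def
proof (intro conjI allI impI ballI)
  fix a b c :: "int ^ 'n" and v assume v: "v \<in> M (q a)" and b: "nonneg b"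
  show "mu (q a) (q (a + b) - q a) v \<in> M (q (a + b))"
    using mu_in[OF nonneg_q[OF b] v, of a] by simp
  assume c: "nonneg c"
  show "mu (q (a + b)) (q (a + b + c) - q (a + b)) (mu (q a) (q (a + b) - q a) v)
      = mu (q a) (q (a + (b + c)) - q a) v"
    using mu_mu'[OF nonneg_q[OF b] nonneg_q[OF c] v, of "q (a + b)" a "a + b"] by (simp add: add.assoc)
qed (auto simp: vs.vector_space_axioms subspace_M mu_add mu_sc nonneg_q mu_id)

lemma fg_pull: "fg_graded_module sc (pull_M q M) (pull_mu q mu)"
proof -
  obtain G where G: "finite G" "\<forall>(a, m)\<in>G. m \<in> M a"
    "\<And>c. M c \<subseteq> vs.span {mu a (c - a) m | a m. (a, m) \<in> G \<and> nonneg (c - a)}"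
    using fg unfolding fg_graded_module_def by blast
  let ?l = "upd i lam"
  have nl: "nonneg (q (?l a) - a)" for a using nonneg_q_diff[of "?l a" a] by simp
  \<comment> \<open>A generator of degree \<open>a\<close> first appears in the pull-back at
    \<open>?l a\<close>, the least degree whose image under \<open>q\<close> dominates
    \<open>a\<close>; there it is represented by its multiple of degree
    \<open>q (?l a)\<close>.\<close>
  define h where "h = (\<lambda>(a, m). (?l a, mu a (q (?l a) - a) m))"
  have "\<forall>(a, m)\<in>h ` G. m \<in> pull_M q M a"
  proof clarify
    fix a' m' a m assume am: "(a', m') = h (a, m)" "(a, m) \<in> G"
    have "mu a (q (?l a) - a) m \<in> M (a + (q (?l a) - a))"
      using am G(2) nl by (intro mu_in) auto
    then show "m' \<in> pull_M q M a'" using am by (simp add: h_def pull_M_def)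
  qed
  moreover have "pull_M q M c \<subseteq> vs.span {pull_mu q mu a (c - a) m | a m. (a, m) \<in> h ` G \<and> nonneg (c - a)}" for c
  proof -
    have "{mu a (q c - a) m | a m. (a, m) \<in> G \<and> nonneg (q c - a)}
        \<subseteq> {pull_mu q mu a (c - a) m | a m. (a, m) \<in> h ` G \<and> nonneg (c - a)}"
    proof clarify
      fix a m assume am: "(a, m) \<in> G" "nonneg (q c - a)"
      have nc: "nonneg (c - ?l a)" using am nonneg_q_diff by simp
      have "mu (q (?l a)) (q (?l a + (c - ?l a)) - q (?l a)) (mu a (q (?l a) - a) m) =
          mu a (q (?l a) - a + (q (?l a + (c - ?l a)) - q (?l a))) m"
        using am G(2) by (intro mu_mu' nl nonneg_q[OF nc]) auto
      then have "mu a (q c - a) m = pull_mu q mu (?l a) (c - ?l a) (mu a (q (?l a) - a) m)"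
        by (simp add: pull_mu_def)
      moreover have "(?l a, mu a (q (?l a) - a) m) \<in> h ` G"
        using am(1) by (intro image_eqI[of _ _ "(a, m)"]) (auto simp: h_def)
      ultimately show "\<exists>a' m'. mu a (q c - a) m = pull_mu q mu a' (c - a') m' \<and> (a', m') \<in> h ` G \<and> nonneg (c - a')"
        using nc by blast
    qed
    then show ?thesis using G(3)[of "q c"] vs.span_mono unfolding pull_M_def by blast
  qed
  ultimately show ?thesis
    unfolding fg_graded_module_def using graded_module_pull G(1) by blast
qed

sublocale N: fg_graded_mod sc "pull_M q M" "pull_mu q mu"
  by unfold_locales (rule fg_pull)

section \<open>Layers of the pull-back in direction i\<close>

definition fix_coord :: "int \<Rightarrow> int ^ 'n \<Rightarrow> int ^ 'n" where
  "fix_coord t = upd i (\<lambda>_. t)"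

text \<open>The part of \<open>w\<close> in i-degree \<open>t\<close>, regarded as an element of M
  in i-degree \<open>p t\<close>; \<open>unslice t\<close> goes back. Both are compatible with the
  variables other than x_i.\<close>

definition slice :: "int \<Rightarrow> (int ^ 'n \<Rightarrow> 'v) \<Rightarrow> int ^ 'n \<Rightarrow> 'v" where
  "slice t w = (\<lambda>c. if c $ i = p t then w (fix_coord t c) else 0)"

definition unslice :: "int \<Rightarrow> (int ^ 'n \<Rightarrow> 'v) \<Rightarrow> int ^ 'n \<Rightarrow> 'v" where
  "unslice t u = (\<lambda>c. if c $ i = t then u (q c) else 0)"

lemma q_fix_coord: "c $ i = p t \<Longrightarrow> q (fix_coord t c) = c"
  and fix_coord_q: "c $ i = t \<Longrightarrow> fix_coord t (q c) = c"
  by (auto simp: fix_coord_def vec_eq_iff)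

lemma slice_in: "w \<in> N.X \<Longrightarrow> slice t w \<in> X"
proof (rule X_I[of "q ` {c. w c \<noteq> 0}"])
  assume w: "w \<in> N.X"
  show "finite (q ` {c. w c \<noteq> 0})" using N.X_finite[OF w] by simp
  show "slice t w c = 0" if "c \<notin> q ` {c. w c \<noteq> 0}" for c
    using that q_fix_coord[of c t] by (force simp: slice_def)
  show "slice t w c \<in> M c" for c
    using N.X_comp[OF w, of "fix_coord t c"] q_fix_coord[of c t] by (auto simp: slice_def M_0 pull_M_def)
qed

lemma unslice_in: "u \<in> X \<Longrightarrow> unslice t u \<in> N.X"
proof (rule N.X_I[of "fix_coord t ` {c. u c \<noteq> 0}"])
  assume u: "u \<in> X"
  show "finite (fix_coord t ` {c. u c \<noteq> 0})" using X_finite[OF u] by simp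
  show "unslice t u c = 0" if "c \<notin> fix_coord t ` {c. u c \<noteq> 0}" for c
    using that fix_coord_q[of c t] by (force simp: unslice_def)
  show "unslice t u c \<in> pull_M q M c" for c
    using X_comp[OF u, of "q c"] by (auto simp: unslice_def M_0 pull_M_def)
qed

text \<open>For exponents with i-th entry 0 the map \<open>q\<close> commutes with the shift, so the
  pull-back acts as M does.\<close>

lemma N_act:
  assumes "{b. g b \<noteq> 0} \<subseteq> exps (- {i})"
  shows "N.act g w c = (\<Sum>b\<in>{b. g b \<noteq> 0}. sc (g b) (mu (q c - b) b (w (c - b))))"
  unfolding pact_def
proof (intro sum.cong refl)
  fix b assume "b \<in> {b. g b \<noteq> 0}"
  then have "b $ i = 0" using assms by (auto simp: exps_def)
  then have "q (c - b) = q c - b" by (auto simp: vec_eq_iff)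
  then show "sc (g b) (pull_mu q mu (c - b) b (w (c - b))) = sc (g b) (mu (q c - b) b (w (c - b)))"
    by (simp add: pull_mu_def)
qed

lemma slice_act:
  assumes g: "{b. g b \<noteq> 0} \<subseteq> exps (- {i})"
  shows "slice t (N.act g w) = act g (slice t w)"
proof
  fix c
  have b: "b $ i = 0 \<and> nonneg b" if "g b \<noteq> 0" for b
    using that g by (auto simp: exps_def)
  show "slice t (N.act g w) c = act g (slice t w) c"
  proof (cases "c $ i = p t")
    case True
    have "slice t w (c - b) = w (fix_coord t c - b)" if "g b \<noteq> 0" for b
    proof -
      have "fix_coord t (c - b) = fix_coord t c - b"
        using b[OF that] by (auto simp: fix_coord_def vec_eq_iff)
      then show ?thesis using True b[OF that] by (simp add: slice_def)
    qed
    then have "act g (slice t w) c = (\<Sum>b\<in>{b. g b \<noteq> 0}. sc (g b) (mu (c - b) b (w (fix_coord t c - b))))"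
      by (simp add: pact_def)
    also have "\<dots> = N.act g w (fix_coord t c)"
      unfolding N_act[OF g] q_fix_coord[of c t, OF True] ..
    finally show ?thesis using True by (simp add: slice_def)
  next
    case False
    have "act g (slice t w) c = 0"
      unfolding pact_def
    proof (rule sum.neutral, rule ballI)
      fix d assume "d \<in> {b. g b \<noteq> 0}"
      then show "sc (g d) (mu (c - d) d (slice t w (c - d))) = 0"
        using False b[of d] by (simp add: slice_def mu_0)
    qed
    then show ?thesis using False by (simp add: slice_def)
  qed
qed

lemma unslice_act:
  assumes g: "{b. g b \<noteq> 0} \<subseteq> exps (- {i})"
  shows "unslice t (act g u) = N.act g (unslice t u)"
proof
  fix c
  have b: "b $ i = 0 \<and> nonneg b" if "g b \<noteq> 0" for b
    using that g by (auto simp: exps_def)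
  show "unslice t (act g u) c = N.act g (unslice t u) c"
  proof (cases "c $ i = t")
    case True
    have "unslice t u (c - b) = u (q c - b)" if "g b \<noteq> 0" for b
    proof -
      have "q (c - b) = q c - b" using b[OF that] by (auto simp: vec_eq_iff)
      then show ?thesis using True b[OF that] by (simp add: unslice_def)
    qed
    then have "N.act g (unslice t u) c = act g u (q c)"
      by (subst N_act[OF g]) (simp add: pact_def)
    then show ?thesis using True by (simp add: unslice_def)
  next
    case False
    have "N.act g (unslice t u) c = 0"
      unfolding N_act[OF g]
    proof (rule sum.neutral, rule ballI)
      fix d assume "d \<in> {b. g b \<noteq> 0}"
      then show "sc (g d) (mu (q c - d) d (unslice t u (c - d))) = 0"
        using False b[of d] by (simp add: unslice_def mu_0)
    qed
    then show ?thesis using False by (simp add: unslice_def)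
  qed
qed

lemma slice_ideal:
  assumes gs: "\<forall>g\<in>set gs. {b. g b \<noteq> 0} \<subseteq> exps (- {i})"
    and w: "w \<in> ideal_times sc (pull_M q M) (pull_mu q mu) gs"
  shows "slice t w \<in> ideal_times sc M mu gs"
proof -
  obtain v where v: "\<forall>l<length gs. module_elem (pull_M q M) (v l)"
    and eq: "w = (\<lambda>c. \<Sum>l<length gs. N.act (gs ! l) (v l) c)"
    using w by (auto simp: ideal_times_def)
  have "slice t w = (\<lambda>c. \<Sum>l<length gs. slice t (N.act (gs ! l) (v l)) c)"
    unfolding eq by (auto simp: slice_def fun_eq_iff)
  also have "\<dots> = (\<lambda>c. \<Sum>l<length gs. act (gs ! l) (slice t (v l)) c)"
    using gs by (intro ext sum.cong refl) (simp add: slice_act)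
  finally show ?thesis
    unfolding ideal_times_def using slice_in v
    by (intro CollectI exI[of _ "\<lambda>l. slice t (v l)"]) (auto simp: X_def N.X_def)
qed

lemma unslice_ideal:
  assumes gs: "\<forall>g\<in>set gs. {b. g b \<noteq> 0} \<subseteq> exps (- {i})"
    and u: "u \<in> ideal_times sc M mu gs"
  shows "unslice t u \<in> ideal_times sc (pull_M q M) (pull_mu q mu) gs"
proof -
  obtain v where v: "\<forall>l<length gs. module_elem M (v l)"
    and eq: "u = (\<lambda>c. \<Sum>l<length gs. act (gs ! l) (v l) c)"
    using u by (auto simp: ideal_times_def)
  have "unslice t u = (\<lambda>c. \<Sum>l<length gs. unslice t (act (gs ! l) (v l)) c)"
    unfolding eq by (auto simp: unslice_def fun_eq_iff)
  also have "\<dots> = (\<lambda>c. \<Sum>l<length gs. N.act (gs ! l) (unslice t (v l)) c)"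
    using gs by (intro ext sum.cong refl) (simp add: unslice_act)
  finally show ?thesis
    unfolding ideal_times_def using unslice_in v
    by (intro CollectI exI[of _ "\<lambda>l. unslice t (v l)"]) (auto simp: X_def N.X_def)
qed

lemma sum_unslice_slice:
  assumes w: "w \<in> N.X"
  shows "w = (\<Sum>t\<in>(\<lambda>c. c $ i) ` {c. w c \<noteq> 0}. unslice t (slice t w))"
proof
  fix c
  have 1: "unslice t (slice t w) c = (if c $ i = t then w c else 0)" for t
    by (auto simp: unslice_def slice_def fix_coord_q)
  show "w c = (\<Sum>t\<in>(\<lambda>c. c $ i) ` {c. w c \<noteq> 0}. unslice t (slice t w)) c"
    unfolding sum_fun_apply 1 using N.X_finite[OF w] by auto
qed

text \<open>Since the polynomials avoid x_i, they act on each layer separately; an element is the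
  finite sum of its layers, and each of these can be moved to M and back.\<close>

lemma ideal_iff_slices:
  assumes gs: "\<forall>g\<in>set gs. finite {b. g b \<noteq> 0} \<and> {b. g b \<noteq> 0} \<subseteq> exps (- {i})" and w: "w \<in> N.X"
  shows "w \<in> ideal_times sc (pull_M q M) (pull_mu q mu) gs \<longleftrightarrow> (\<forall>t. slice t w \<in> ideal_times sc M mu gs)"
proof
  assume sl: "\<forall>t. slice t w \<in> ideal_times sc M mu gs"
  have "N.na.submod (ideal_times sc (pull_M q M) (pull_mu q mu) gs)"
    using gs exps_nonneg by (intro N.submod_ideal_times) blast
  then show "w \<in> ideal_times sc (pull_M q M) (pull_mu q mu) gs"
    using sl gs by (subst sum_unslice_slice[OF w]) (auto intro!: N.na.submod_sum unslice_ideal)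
qed (use gs slice_ideal in blast)

text \<open>In the pull-back x_i leads from layer \<open>t\<close> to layer \<open>t + 1\<close>,
  which in M is a power of x_i whose exponent may be 0 or exceed 1.\<close>

lemma slice_mon_i:
  "slice (t + 1) (N.mon (axis i 1) w) = mon (axis i (p (t + 1) - p t)) (slice t w)"
proof
  fix c
  let ?a = "axis i (p (t + 1) - p t)"
  have nn: "nonneg ?a" using p_mono[of t "t + 1"] by (auto simp: nonneg_def axis_def)
  show "slice (t + 1) (N.mon (axis i 1) w) c = mon ?a (slice t w) c"
  proof (cases "c $ i = p (t + 1)")
    case True
    have 1: "fix_coord (t + 1) c - axis i 1 = fix_coord t c"
      by (auto simp: fix_coord_def vec_eq_iff axis_def)
    have 2: "q (fix_coord t c) = c - ?a" using True
      by (auto simp: fix_coord_def vec_eq_iff axis_def)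
    have 3: "fix_coord t c + axis i 1 = fix_coord (t + 1) c" using 1 by (simp add: algebra_simps)
    have 4: "fix_coord t (c - ?a) = fix_coord t c"
      by (auto simp: fix_coord_def vec_eq_iff axis_def)
    have "slice (t + 1) (N.mon (axis i 1) w) c = N.mon (axis i 1) w (fix_coord (t + 1) c)"
      using True by (simp add: slice_def)
    also have "\<dots> = mu (c - ?a) ?a (w (fix_coord t c))"
      unfolding N.mon_def 1 unfolding pull_mu_def 2 3 q_fix_coord[OF True] by simp
    also have "\<dots> = mon ?a (slice t w) c"
      using True by (simp add: mon_def slice_def 4)
    finally show ?thesis .
  next
    case False
    then show ?thesis by (simp add: slice_def mon_def mu_0[OF nn])
  qed
qed

text \<open>Regularity is tested layer by layer. A layer of a socle element is killed modulo
  \<open>?K\<close> by the variables other than x_i and, by \<open>slice_mon_i\<close>, by some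
  power of x_i; the socle condition in M removes that power step by step.\<close>

lemma almost_regular_pull:
  assumes ar: "almost_regular i gs" shows "N.almost_regular i gs"
proof -
  have gs: "\<forall>g\<in>set gs. finite {b. g b \<noteq> 0} \<and> {b. g b \<noteq> 0} \<subseteq> exps (- {i})"
    using ar by (simp add: almost_regular_def)
  let ?K = "ideal_times sc M mu gs"
  have K: "na.submod ?K"
    using gs exps_nonneg by (intro submod_ideal_times) blast
  have soc: "u \<in> ?K" if "u \<in> X" "\<And>k. mon (axis k 1) u \<in> ?K" for u
    using ar that by (simp add: almost_regular_def)
  \<comment> \<open>Exponent 0 is a genuine case: it occurs where \<open>p\<close> identifies two
    adjacent layers, and then the assumption already places \<open>u\<close> in
    \<open>?K\<close>.\<close>
  have lower: "u \<in> ?K" if "u \<in> X" "\<And>k. k \<noteq> i \<Longrightarrow> mon (axis k 1) u \<in> ?K" "mon (axis i (int a)) u \<in> ?K" for u a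
    using that(3)
  proof (induction a)
    case 0
    then show ?case using mon_id[OF that(1)] by (simp add: axis_def zero_vec_def)
  next
    case (Suc a)
    have nn: "nonneg (axis i (int a) :: int ^ 'n)" by (auto simp: nonneg_def axis_def)
    have "mon (axis k 1) (mon (axis i (int a)) u) \<in> ?K" for k
    proof (cases "k = i")
      case True
      have "axis i 1 + axis i (int a) = (axis i (int (Suc a)) :: int ^ 'n)"
        by (auto simp: vec_eq_iff axis_def)
      then show ?thesis using Suc.prems True mon_mon[OF nonneg_axis nn that(1), of i] by simp
    next
      case False
      have "mon (axis k 1) (mon (axis i (int a)) u) = mon (axis i (int a)) (mon (axis k 1) u)"
        by (simp add: mon_mon nn that(1) add.commute)
      also have "\<dots> \<in> ?K"
        using na.submodD(5)[OF K _ that(2)[OF False]] poly_op_mon[of "axis i (int a)" NN] nn by simp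
      finally show ?thesis .
    qed
    then have "mon (axis i (int a)) u \<in> ?K" using soc mon_in[OF nn that(1)] by blast
    then show ?case by (rule Suc.IH)
  qed
  have "w \<in> ideal_times sc (pull_M q M) (pull_mu q mu) (take l gs)"
    if l: "l < length gs" and w: "w \<in> N.X"
      "N.act (gs ! l) w \<in> ideal_times sc (pull_M q M) (pull_mu q mu) (take l gs)" for l w
  proof -
    have gl: "{b. (gs ! l) b \<noteq> 0} \<subseteq> exps (- {i})" using gs l by auto
    have gt: "\<forall>g\<in>set (take l gs). finite {b. g b \<noteq> 0} \<and> {b. g b \<noteq> 0} \<subseteq> exps (- {i})"
      using gs by (meson in_set_takeD)
    have "slice t w \<in> ideal_times sc M mu (take l gs)" for t
    proof -
      have "act (gs ! l) (slice t w) \<in> ideal_times sc M mu (take l gs)"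
        using slice_ideal[OF _ w(2), of t] gt by (simp add: slice_act[OF gl])
      then show ?thesis using ar l slice_in[OF w(1)] by (simp add: almost_regular_def)
    qed
    then show ?thesis using ideal_iff_slices[OF gt w(1)] by blast
  qed
  moreover have "w \<in> ideal_times sc (pull_M q M) (pull_mu q mu) gs"
    if w: "w \<in> N.X" "\<And>k. N.mon (axis k 1) w \<in> ideal_times sc (pull_M q M) (pull_mu q mu) gs" for w
  proof -
    have "slice t w \<in> ?K" for t
    proof (rule lower[of _ "nat (p (t + 1) - p t)"])
      show "slice t w \<in> X" using slice_in[OF w(1)] .
      show "mon (axis k 1) (slice t w) \<in> ?K" if k: "k \<noteq> i" for k
      proof -
        let ?d = "\<lambda>c. if c = axis k 1 then 1 else 0"
        have "{b. ?d b \<noteq> 0} \<subseteq> exps (- {i})" using axis_exps[of k "- {i}"] k by auto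
        from slice_act[OF this, of t w] have "slice t (N.mon (axis k 1) w) = mon (axis k 1) (slice t w)"
          by (simp add: act_monomial N.act_monomial)
        then show ?thesis using slice_ideal[OF _ w(2), of t k] gs by simp
      qed
      have "mon (axis i (p (t + 1) - p t)) (slice t w) \<in> ?K"
        using slice_ideal[OF _ w(2), of "t + 1" i] gs by (simp add: slice_mon_i)
      then show "mon (axis i (int (nat (p (t + 1) - p t)))) (slice t w) \<in> ?K"
        using p_mono[of t "t + 1"] by simp
    qed
    then show ?thesis using ideal_iff_slices[OF gs w(1)] by blast
  qed
  ultimately show ?thesis unfolding N.almost_regular_def using gs by blast
qed

text \<open>A nonempty sequence loses one element on the way to \<open>almost_regular\<close> and
  regains one afterwards. Nonvanishing of the pull-back is assumed because \<open>p\<close> may skip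
  all degrees in which M lives.\<close>

lemma regular_sequence_pull:
  assumes "regular_sequence sc M mu fs" "pull_M q M c \<noteq> {0}"
  shows "\<exists>gs. length gs = length fs \<and> regular_sequence sc (pull_M q M) (pull_mu q mu) gs"
proof (cases "length fs")
  case 0
  then show ?thesis using assms(2) by (auto simp: N.regular_sequence_iff)
next
  case (Suc d)
  then obtain gs where "length gs = d" "almost_regular i gs"
    using regular_imp_almost_regular assms(1) by blast
  then show ?thesis
    using N.almost_regular_imp_regular[OF almost_regular_pull assms(2)] Suc by metis
qed

end

section \<open>Stanley decompositions\<close>

text \<open>A family of subsets \<open>Ws\<close> decomposes \<open>v\<close> uniquely iff the family of its members different from
  \<open>{0}\<close> does; this is what allows Stanley spaces to be split or dropped degree by degree.\<close>
fun summands :: "'v::ab_group_add set list \<Rightarrow> 'v \<Rightarrow> 'v list set" where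
  "summands [] v = (if v = 0 then {[]} else {})"
| "summands (W # Ws) v = {x # xs | x xs. x \<in> W \<and> xs \<in> summands Ws (v - x)}"

text \<open>Existence and uniqueness are separated because each passes through the recursion of
  \<open>summands\<close> in its own way.\<close>

definition at_most_one :: "'a set \<Rightarrow> bool" where
  "at_most_one A \<longleftrightarrow> (\<forall>x\<in>A. \<forall>y\<in>A. x = y)"

lemma summands_nonempty_filter:
  "summands (filter (\<lambda>W. W \<noteq> {0}) Ws) v \<noteq> {} \<longleftrightarrow> summands Ws v \<noteq> {}"
proof (induction Ws arbitrary: v)
  case (Cons W Ws)
  have step: "summands (W # Us) v \<noteq> {} \<longleftrightarrow> (\<exists>x\<in>W. summands Us (v - x) \<noteq> {})" for Us v
    by auto
  show ?case using Cons.IH step[of Ws v] step[of "filter (\<lambda>W. W \<noteq> {0}) Ws" v] by simp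
qed simp

lemma at_most_one_summands_Cons:
  "at_most_one (summands (W # Ws) v) \<longleftrightarrow>
     (\<forall>x\<in>W. at_most_one (summands Ws (v - x))) \<and>
     at_most_one {x \<in> W. summands Ws (v - x) \<noteq> {}}"
  unfolding at_most_one_def by auto blast+

lemma at_most_one_summands_filter:
  "at_most_one (summands (filter (\<lambda>W. W \<noteq> {0}) Ws) v) \<longleftrightarrow> at_most_one (summands Ws v)"
proof (induction Ws arbitrary: v)
  case (Cons W Ws)
  show ?case
  proof (cases "W = {0}")
    case True
    then have "at_most_one (summands (W # Ws) v) \<longleftrightarrow> at_most_one (summands Ws v)"
      unfolding at_most_one_summands_Cons by (auto simp: at_most_one_def)
    then show ?thesis using True Cons.IH by simp
  next
    case False
    then have "filter (\<lambda>W. W \<noteq> {0}) (W # Ws) = W # filter (\<lambda>W. W \<noteq> {0}) Ws" by simp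
    then show ?thesis
      by (simp only: at_most_one_summands_Cons Cons.IH summands_nonempty_filter)
  qed
qed simp

lemma ex1_summands_iff: "(\<exists>!xs. xs \<in> summands Ws v) \<longleftrightarrow> summands Ws v \<noteq> {} \<and> at_most_one (summands Ws v)"
  unfolding at_most_one_def by auto

lemma summands_eq:
  "summands Ws v = {xs. length xs = length Ws \<and> (\<forall>l<length Ws. xs ! l \<in> Ws ! l) \<and> v = sum_list xs}"
proof (induction Ws arbitrary: v)
  case (Cons W Ws)
  show ?case
  proof (intro set_eqI iffI)
    fix xs assume "xs \<in> summands (W # Ws) v"
    then show "xs \<in> {xs. length xs = length (W # Ws) \<and> (\<forall>l<length (W # Ws). xs ! l \<in> (W # Ws) ! l) \<and> v = sum_list xs}"
      by (auto simp: Cons.IH nth_Cons' algebra_simps)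
  next
    fix xs assume "xs \<in> {xs. length xs = length (W # Ws) \<and> (\<forall>l<length (W # Ws). xs ! l \<in> (W # Ws) ! l) \<and> v = sum_list xs}"
    then show "xs \<in> summands (W # Ws) v"
      by (cases xs) (force simp: Cons.IH)+
  qed
qed auto

lemma ex1_transfer:
  assumes "\<And>w. P w \<Longrightarrow> Q (f w) \<and> g (f w) = w" "\<And>x. Q x \<Longrightarrow> P (g x) \<and> f (g x) = x"
  shows "(\<exists>!w. P w) \<longleftrightarrow> (\<exists>!x. Q x)"
  using assms by metis

lemma ex1_family_iff_ex1_summands:
  fixes Ws :: "'v::ab_group_add set list"
  shows "(\<exists>!w. (\<forall>l<length Ws. w l \<in> Ws ! l) \<and> (\<forall>l\<ge>length Ws. w l = 0) \<and> v = (\<Sum>l<length Ws. w l))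
    \<longleftrightarrow> (\<exists>!xs. xs \<in> summands Ws v)" (is "(\<exists>!w. ?P w) \<longleftrightarrow> _")
proof -
  define f :: "(nat \<Rightarrow> 'v) \<Rightarrow> 'v list" where "f w = map w [0..<length Ws]" for w
  define g :: "'v list \<Rightarrow> nat \<Rightarrow> 'v" where "g xs = (\<lambda>l. if l < length Ws then xs ! l else 0)" for xs
  have 1: "f w \<in> summands Ws v \<and> g (f w) = w" if "?P w" for w
    using that by (auto simp: f_def g_def summands_eq interv_sum_list_conv_sum_set_nat atLeast0LessThan fun_eq_iff)
  have 2: "?P (g xs) \<and> f (g xs) = xs" if "xs \<in> summands Ws v" for xs
    using that by (auto simp: f_def g_def summands_eq sum_list_sum_nth atLeast0LessThan intro!: nth_equalityI sum.cong)
  show ?thesis by (rule ex1_transfer[where f = f and g = g]) (erule 1, erule 2)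
qed

text \<open>Dropping the components equal to \<open>{0}\<close> lets a decomposition and its
  pull-back, lists of different lengths, be compared in each degree as equal lists.\<close>

lemma stanley_decomposition_iff:
  "stanley_decomposition sc M mu D \<longleftrightarrow> (\<forall>T\<in>set D. stanley_space sc M mu T) \<and>
     (\<forall>c. \<forall>v\<in>M c. \<exists>!xs. xs \<in> summands (filter (\<lambda>W. W \<noteq> {0}) (map (\<lambda>T. stanley_comp sc mu T c) D)) v)"
proof -
  have "(\<exists>!w. (\<forall>l<length D. w l \<in> stanley_comp sc mu (D ! l) c) \<and> (\<forall>l\<ge>length D. w l = 0) \<and> v = (\<Sum>l<length D. w l))
    \<longleftrightarrow> (\<exists>!xs. xs \<in> summands (filter (\<lambda>W. W \<noteq> {0}) (map (\<lambda>T. stanley_comp sc mu T c) D)) v)" for c v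
    using ex1_family_iff_ex1_summands[of "map (\<lambda>T. stanley_comp sc mu T c) D" v]
    by (simp add: ex1_summands_iff summands_nonempty_filter at_most_one_summands_filter)
  then show ?thesis by (simp add: stanley_decomposition_def)
qed

lemma filter_map_single:
  assumes "distinct xs"
  shows "filter (\<lambda>W. W \<noteq> {0}) (map (\<lambda>s. if s = x then W else {0}) xs)
    = (if x \<in> set xs then filter (\<lambda>W. W \<noteq> {0}) [W] else [])"
  using assms by (induction xs) auto

section \<open>Pulling back Stanley spaces\<close>

context coord_pull
begin

text \<open>If x_i is in \<open>Z\<close>, the ray from \<open>a $ i\<close> pulls back to the ray
  from \<open>lam (a $ i)\<close>. Otherwise the interval is the fibre of \<open>p\<close> over
  \<open>a $ i\<close>, by \<open>p_eq_iff\<close>; it is empty where \<open>p\<close> skips a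
  value, and then the space disappears.\<close>

definition starts :: "int ^ 'n \<Rightarrow> 'n set \<Rightarrow> (int ^ 'n) list" where
  "starts a Z = (if i \<in> Z then [upd i lam a]
     else map (\<lambda>s. upd i (\<lambda>_. s) a) [lam (a $ i)..lam (a $ i + 1) - 1])"

definition pieces :: "(int ^ 'n) \<times> 'v \<times> 'n set \<Rightarrow> ((int ^ 'n) \<times> 'v \<times> 'n set) list" where
  "pieces T = (case T of (a, m, Z) \<Rightarrow> map (\<lambda>a'. (a', mu a (q a' - a) m, Z)) (starts a Z))"

lemma distinct_starts: "distinct (starts a Z)"
  by (auto simp: starts_def distinct_map inj_on_def vec_eq_iff)

lemma p_eq_iff: "p s = t \<longleftrightarrow> lam t \<le> s \<and> s < lam (t + 1)"
  using galois[of t s] galois[of "t + 1" s] by linarith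

lemma supp_in_component:
  "supp_in b Z \<longleftrightarrow> (\<forall>k. (k \<in> Z \<longrightarrow> 0 \<le> b $ k) \<and> (k \<notin> Z \<longrightarrow> b $ k = 0))"
  unfolding supp_in_def nonneg_def by (metis order.refl)

text \<open>Together with \<open>supp_in_starts_unique\<close>: the pieces partition the degrees
  occupied by the pull-back of a Stanley space.\<close>

lemma supp_in_starts:
  "supp_in (q c - a) Z \<longleftrightarrow> (\<exists>a'\<in>set (starts a Z). supp_in (c - a') Z)"
proof (cases "i \<in> Z")
  case True
  then show ?thesis using galois by (auto simp: supp_in_component starts_def)
next
  case False
  have "supp_in (q c - a) Z \<longleftrightarrow> p (c $ i) = a $ i \<and> (\<forall>k. k \<noteq> i \<longrightarrow> (k \<in> Z \<longrightarrow> a $ k \<le> c $ k) \<and> (k \<notin> Z \<longrightarrow> c $ k = a $ k))"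
    using False by (auto simp: supp_in_component)
  moreover have "supp_in (c - upd i (\<lambda>_. s) a) Z \<longleftrightarrow> c $ i = s \<and> (\<forall>k. k \<noteq> i \<longrightarrow> (k \<in> Z \<longrightarrow> a $ k \<le> c $ k) \<and> (k \<notin> Z \<longrightarrow> c $ k = a $ k))" for s
    using False by (auto simp: supp_in_component)
  ultimately show ?thesis using False by (auto simp: starts_def p_eq_iff)
qed

lemma supp_in_starts_unique:
  assumes "a' \<in> set (starts a Z)" "a'' \<in> set (starts a Z)" "supp_in (c - a') Z" "supp_in (c - a'') Z"
  shows "a' = a''"
proof (cases "i \<in> Z")
  case True
  then show ?thesis using assms by (simp add: starts_def)
next
  case False
  then obtain s t where st: "a' = upd i (\<lambda>_. s) a" "a'' = upd i (\<lambda>_. t) a"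
    using assms(1,2) by (auto simp: starts_def)
  have "c $ i - a' $ i = 0" "c $ i - a'' $ i = 0"
    using assms(3,4) False by (auto simp: supp_in_component)
  then show ?thesis using st by simp
qed

text \<open>Exponents reached from a piece stay supported in \<open>Z\<close> when measured from
  \<open>a\<close>, so freeness of the piece is inherited from the original space.\<close>

lemma mu_start:
  assumes "stanley_space sc M mu (a, m, Z)" and "a' \<in> set (starts a Z)" and "supp_in b Z"
  shows "pull_mu q mu a' b (mu a (q a' - a) m) = mu a (q (a' + b) - a) m"
    and "supp_in (q (a' + b) - a) Z" "mu a (q a' - a) m \<in> M (q a')"
proof -
  have m: "m \<in> M a" using assms(1) by (simp add: stanley_space_def)
  have "supp_in (a' - a') Z" by (simp add: supp_in_component)
  then have "supp_in (q a' - a) Z" using supp_in_starts assms(2) by blast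
  then have n: "nonneg (q a' - a)" by (simp add: supp_in_def)
  have "nonneg b" using assms(3) by (simp add: supp_in_def)
  then have nb: "nonneg (q (a' + b) - q a')" by (rule nonneg_q)
  have "mu (q a') (q (a' + b) - q a') (mu a (q a' - a) m) = mu a (q a' - a + (q (a' + b) - q a')) m"
    by (rule mu_mu'[OF n nb m]) simp
  then show "pull_mu q mu a' b (mu a (q a' - a) m) = mu a (q (a' + b) - a) m"
    by (simp add: pull_mu_def)
  show "supp_in (q (a' + b) - a) Z"
    unfolding supp_in_starts using assms by (intro bexI[of _ a']) simp
  show "mu a (q a' - a) m \<in> M (q a')" using mu_in[OF n m] by simp
qed

lemma stanley_space_pieces:
  assumes "stanley_space sc M mu T" "T' \<in> set (pieces T)"
  shows "stanley_space sc (pull_M q M) (pull_mu q mu) T'"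
proof -
  obtain a m Z where T: "T = (a, m, Z)" by (cases T)
  then obtain a' where T': "T' = (a', mu a (q a' - a) m, Z)" "a' \<in> set (starts a Z)"
    using assms(2) by (auto simp: pieces_def)
  note ms = mu_start[OF assms(1)[unfolded T] T'(2)]
  have "pull_mu q mu a' b (mu a (q a' - a) m) \<noteq> 0" if "supp_in b Z" for b
    using ms(1,2)[OF that] assms(1) by (simp add: T stanley_space_def)
  moreover have "mu a (q a' - a) m \<in> M (q a')" using ms(3)[of 0] by (simp add: supp_in_component)
  ultimately show ?thesis by (simp add: T' stanley_space_def pull_M_def)
qed

text \<open>At most one piece is active in degree \<open>c\<close>, and it contributes the component
  of \<open>T\<close> in degree \<open>q c\<close>; the filter removes the others and also covers
  the absence of an active piece.\<close>

lemma stanley_comp_pieces: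
  assumes "stanley_space sc M mu T"
  shows "filter (\<lambda>W. W \<noteq> {0}) (map (\<lambda>T'. stanley_comp sc (pull_mu q mu) T' c) (pieces T))
    = filter (\<lambda>W. W \<noteq> {0}) [stanley_comp sc mu T (q c)]"
proof -
  obtain a m Z where T: "T = (a, m, Z)" by (cases T)
  let ?W = "range (\<lambda>t. sc t (mu a (q c - a) m))"
  have "map (\<lambda>T'. stanley_comp sc (pull_mu q mu) T' c) (pieces T)
      = map (\<lambda>a'. if supp_in (c - a') Z then ?W else {0}) (starts a Z)"
    using mu_start(1)[OF assms[unfolded T], of _ "c - _"]
    by (auto simp: T pieces_def stanley_comp_def)
  moreover have "filter (\<lambda>W. W \<noteq> {0}) (map (\<lambda>a'. if supp_in (c - a') Z then ?W else {0}) (starts a Z))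
      = filter (\<lambda>W. W \<noteq> {0}) [stanley_comp sc mu T (q c)]"
  proof (cases "supp_in (q c - a) Z")
    case True
    then obtain a' where a': "a' \<in> set (starts a Z)" "supp_in (c - a') Z"
      using supp_in_starts by blast
    then have eq: "map (\<lambda>b. if supp_in (c - b) Z then ?W else {0}) (starts a Z)
        = map (\<lambda>b. if b = a' then ?W else {0}) (starts a Z)"
      using supp_in_starts_unique by (intro map_cong refl) metis
    show ?thesis
      unfolding eq filter_map_single[OF distinct_starts] using True a'(1) by (simp add: T stanley_comp_def)
  next
    case False
    then show ?thesis using supp_in_starts[of c a Z] by (auto simp: T stanley_comp_def filter_empty_conv)
  qed
  ultimately show ?thesis by simp
qed

lemma stanley_decomposition_pull:
  assumes "stanley_decomposition sc M mu D"
  shows "stanley_decomposition sc (pull_M q M) (pull_mu q mu) (concat (map pieces D))"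
proof -
  have sp: "\<forall>T\<in>set D. stanley_space sc M mu T" using assms by (simp add: stanley_decomposition_def)
  have "filter (\<lambda>W. W \<noteq> {0}) (map (\<lambda>T. stanley_comp sc (pull_mu q mu) T c) (concat (map pieces D)))
      = filter (\<lambda>W. W \<noteq> {0}) (map (\<lambda>T. stanley_comp sc mu T (q c)) D)" for c
    using sp
  proof (induction D)
    case (Cons T D)
    then show ?case using stanley_comp_pieces[of T c] by simp
  qed simp
  then show ?thesis
    using assms sp stanley_space_pieces unfolding stanley_decomposition_iff by (auto simp: pull_M_def)
qed

lemma stanley_depth_pull:
  assumes "stanley_decomposition sc M mu D" "\<forall>(a, m, Z)\<in>set D. d \<le> card Z"
  shows "\<exists>D'. stanley_decomposition sc (pull_M q M) (pull_mu q mu) D' \<and> (\<forall>(a, m, Z)\<in>set D'. d \<le> card Z)"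
  using stanley_decomposition_pull[OF assms(1)] assms(2) by (fastforce simp: pieces_def)

end

theorem theorem3p2:
  fixes sc :: "'k::field \<Rightarrow> 'v::ab_group_add \<Rightarrow> 'v"
    and M :: "int ^ 'n::finite \<Rightarrow> 'v set"
    and mu :: "int ^ 'n \<Rightarrow> int ^ 'n \<Rightarrow> 'v \<Rightarrow> 'v"
    and i :: 'n and j :: int
  assumes "fg_graded_module sc M mu"
  shows "sdepth sc M mu = sdepth sc (pull_M (sigma i j) M) (pull_mu (sigma i j) mu)
    \<and> (depth sc M mu \<le> sdepth sc M mu \<longleftrightarrow>
       depth sc (pull_M (sigma i j) M) (pull_mu (sigma i j) mu)
         \<le> sdepth sc (pull_M (sigma i j) M) (pull_mu (sigma i j) mu))"
proof -
  define s where "s t = (if j \<le> t then t - 1 else t)" for t :: int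
  \<comment> \<open>\<open>s\<close> takes the value \<open>j - 1\<close> twice and \<open>r\<close>
    skips \<open>j\<close>; \<open>r\<close> is both a section of \<open>s\<close> and its lower
    adjoint.\<close>
  define r where "r t = (if j \<le> t then t + 1 else t)" for t :: int
  have sigma: "sigma i j = upd i s"
    by (auto simp: fun_eq_iff sigma_def vec_eq_iff s_def)
  let ?N = "pull_M (upd i s) M" and ?nu = "pull_mu (upd i s) mu"
  have sr: "upd i s (upd i r a) = a" for a :: "int ^ 'n"
    by (auto simp: vec_eq_iff s_def r_def)
  have M_eq: "pull_M (upd i r) ?N = M" and mu_eq: "pull_mu (upd i r) ?nu = mu"
    by (auto simp: pull_M_def pull_mu_def sr)
  interpret P: coord_pull sc M mu i s "\<lambda>t. if j \<le> t then t + 1 else t"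
    using assms by unfold_locales (auto simp: s_def)
  \<comment> \<open>The lower adjoint of \<open>r\<close> is again a shift down by one, now from
    \<open>j + 1\<close> on.\<close>
  interpret Q: coord_pull sc ?N ?nu i r "\<lambda>t. if t \<le> j then t else t - 1"
    using P.fg_pull by unfold_locales (auto simp: r_def)
  \<comment> \<open>The sets themselves agree, not just their suprema, so the value of
    \<open>Sup\<close> on an unbounded set, as it arises for M = 0, does not matter.\<close>
  have "{d. \<exists>D. stanley_decomposition sc M mu D \<and> (\<forall>(a, m, Z)\<in>set D. d \<le> card Z)}
      = {d. \<exists>D. stanley_decomposition sc ?N ?nu D \<and> (\<forall>(a, m, Z)\<in>set D. d \<le> card Z)}"
    using P.stanley_depth_pull Q.stanley_depth_pull unfolding M_eq mu_eq by blast
  then have sd: "sdepth sc M mu = sdepth sc ?N ?nu" by (simp add: sdepth_def)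
  have nz: "?N (upd i r c) = M c" for c by (simp add: pull_M_def sr)
  have "\<exists>gs. length gs = length fs \<and> regular_sequence sc ?N ?nu gs" if fs: "regular_sequence sc M mu fs" for fs
  proof -
    obtain c where "M c \<noteq> {0}" using fs P.regular_sequence_iff by blast
    then show ?thesis using P.regular_sequence_pull[OF fs] nz by metis
  qed
  moreover have "\<exists>gs. length gs = length fs \<and> regular_sequence sc M mu gs" if fs: "regular_sequence sc ?N ?nu fs" for fs
  proof -
    obtain c where "?N c \<noteq> {0}" using fs P.N.regular_sequence_iff by blast
    then have "pull_M (upd i r) ?N (upd i s c) \<noteq> {0}" unfolding M_eq by (simp add: pull_M_def)
    then show ?thesis using Q.regular_sequence_pull[OF fs] unfolding M_eq mu_eq by blast
  qed
  ultimately have "{length fs | fs. regular_sequence sc M mu fs} = {length fs | fs. regular_sequence sc ?N ?nu fs}"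
    by (auto; metis)
  then have "depth sc M mu = depth sc ?N ?nu" by (simp add: depth_def)
  then show ?thesis using sd by (simp add: sigma)
qed

end
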